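(* There exists a constant $\mu>0$, depending only on $(A,B,Q,R,\Sigma,\gamma,x^* )$, such that for all $K,\tilde K\in\mathbb{R}^{k\times n}$ with $\sqrt{\gamma}\,\rho(A+BK)<1$, $$J(K,\tilde K)-J^{\mathrm{opt}}\le \frac{1}{\mu}\,\big\|\nabla J(K,\tilde K)\big\|^2 .$$
   Context: Setting (discounted LQR tracking). Fix integers $n,k\ge 1$, matrices $A\in\mathbb{R}^{n\times n}$, $B\in\mathbb{R}^{n\times k}$ with $(A,B)$ controllable, symmetric positive definite matrices $Q\in\mathbb{R}^{n\times n}$, $R\in\mathbb{R}^{k\times k}$, $\Sigma\in\mathbb{R}^{n\times n}$, a discount factor $0<\gamma<1$ and a target $x^*\in\mathbb{R}^n$. A policy is a pair $(K,\tilde K)$ with $K,\tilde K\in\mathbb{R}^{k\times n}$; it generates the trajectory $x_{t+1}=Ax_t+Bu_t$, $u_t=Kx_t+\tilde Kx^*$, $x_0\sim N(0,\Sigma)$ (only $x_0$ is random). Its cost is $$J(K,\tilde K)=\mathbb{E}\Big[\sum_{t=0}^\infty \gamma^t\big((x_t-x^* )^\top Q(x_t-x^* )+u_t^\top R u_t\big)\Big]\in[0,\infty],$$ and $J^{\mathrm{opt}}=\min_{K,\tilde K}J(K,\tilde K)$ (the minimum is attained). $\rho(\cdot)$ denotes spectral radius. $\nabla J(K,\tilde K)$ is the gradient with respect to all $2nk$ entries of $(K,\tilde K)$, and $\|\cdot\|$ is the Euclidean (Frobenius) norm. *)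

theory Defs
  imports "HOL-Analysis.Analysis"
begin

definition sym_pos_def :: "real^'n^'n \<Rightarrow> bool" where
  "sym_pos_def M \<longleftrightarrow> transpose M = M \<and> (\<forall>x. x \<noteq> 0 \<longrightarrow> 0 < x \<bullet> (M *v x))"

(* The class power operation on real^'n^'n is entrywise, hence this separate constant. *)
primrec mat_pow :: "real^'n^'n \<Rightarrow> nat \<Rightarrow> real^'n^'n" where
  "mat_pow M 0 = mat 1"
| "mat_pow M (Suc i) = M ** mat_pow M i"

(* Kalman rank condition. The set below consists of the columns of the controllability matrix
   [B, AB, ..., A^(n-1) B] with n = CARD('n), and dim of a set is the dimension of its span,
   so the left-hand side is the rank of that matrix. *)
definition controllable :: "real^'n^'n \<Rightarrow> real^'k^'n \<Rightarrow> bool" where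
  "controllable A B \<longleftrightarrow>
     dim (\<Union>i<CARD('n). columns (mat_pow A i ** B)) = CARD('n)"

definition complex_eigenvalues :: "real^'n^'n \<Rightarrow> complex set" where
  "complex_eigenvalues M =
     {z. \<exists>v::complex^'n. v \<noteq> 0 \<and> map_matrix complex_of_real M *v v = z *s v}"

definition spec_radius :: "real^'n^'n \<Rightarrow> real" where
  "spec_radius M = Max (cmod ` complex_eigenvalues M)"

(* N(m, S), given by its Lebesgue density; meaningful for symmetric positive definite S. *)
definition normal_vec :: "real^'n \<Rightarrow> real^'n^'n \<Rightarrow> (real^'n) measure" where
  "normal_vec m S = density lborel (\<lambda>x. ennreal
     (exp (- ((x - m) \<bullet> (matrix_inv S *v (x - m))) / 2) / sqrt ((2 * pi) ^ CARD('n) * det S)))"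

definition policy_input ::
  "real^'n^'k \<Rightarrow> real^'n^'k \<Rightarrow> real^'n \<Rightarrow> real^'n \<Rightarrow> real^'k" where
  "policy_input K Kt xs x = K *v x + Kt *v xs"

primrec trajectory ::
  "real^'n^'n \<Rightarrow> real^'k^'n \<Rightarrow> real^'n \<Rightarrow> real^'n^'k \<Rightarrow> real^'n^'k \<Rightarrow> real^'n \<Rightarrow> nat \<Rightarrow> real^'n" where
  "trajectory A B xs K Kt x0 0 = x0"
| "trajectory A B xs K Kt x0 (Suc t) =
     A *v trajectory A B xs K Kt x0 t
     + B *v policy_input K Kt xs (trajectory A B xs K Kt x0 t)"

definition stage_cost ::
  "real^'n^'n \<Rightarrow> real^'k^'k \<Rightarrow> real^'n \<Rightarrow> real^'n \<Rightarrow> real^'k \<Rightarrow> real" where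
  "stage_cost Q R xs x u = (x - xs) \<bullet> (Q *v (x - xs)) + u \<bullet> (R *v u)"

(* The terms of the series are nonnegative for positive definite Q and R and positive g,
   so ennreal does not truncate them. *)
definition tracking_cost ::
  "real^'n^'n \<Rightarrow> real^'k^'n \<Rightarrow> real^'n^'n \<Rightarrow> real^'k^'k \<Rightarrow> real^'n^'n \<Rightarrow> real \<Rightarrow> real^'n
   \<Rightarrow> real^'n^'k \<Rightarrow> real^'n^'k \<Rightarrow> ennreal" where
  "tracking_cost A B Q R S g xs K Kt =
     (\<integral>\<^sup>+ x0. (\<Sum>t. ennreal (g ^ t *
        stage_cost Q R xs (trajectory A B xs K Kt x0 t)
          (policy_input K Kt xs (trajectory A B xs K Kt x0 t)))) \<partial>normal_vec 0 S)"

definition optimal_cost ::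
  "real^'n^'n \<Rightarrow> real^'k^'n \<Rightarrow> real^'n^'n \<Rightarrow> real^'k^'k \<Rightarrow> real^'n^'n \<Rightarrow> real \<Rightarrow> real^'n
   \<Rightarrow> ennreal" where
  "optimal_cost A B Q R S g xs =
     (INF p :: (real^'n^'k) \<times> (real^'n^'k). tracking_cost A B Q R S g xs (fst p) (snd p))"

end

theory Submission
  imports Defs "HOL-Probability.Distributions"
    "HOL-Computational_Algebra.Fundamental_Theorem_Algebra"
begin

text \<open>
  Gradient dominance holds although the cost is not convex in the policy, because the cost of one
  policy can be compared exactly with that of another. Append the target to the state,
  \<open>z = (x, xs)\<close>; the problem becomes a homogeneous linear-quadratic regulator with the linear
  feedback \<open>u = L p z\<close>, where \<open>p = (K, Kt)\<close>. For a stable policy \<open>p\<close> the value is a quadratic form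
  in \<open>z\<close>. Let \<open>E\<close> be half the gradient of the cost-to-go with respect to the current input
  (\<open>input_grad\<close>). Telescoping the Bellman equation of \<open>p\<close> along the trajectory \<open>z\<^sub>t\<close> of another
  policy \<open>p + h\<close> gives, with a form \<open>H \<ge> R\<close>,

  \<open>val (p + h) z = val p z + \<Sum>\<^sub>t \<gamma>\<^sup>t (2 E z\<^sub>t \<bullet> L h z\<^sub>t + H (L h z\<^sub>t))\<close>

  (\<open>performance_difference\<close>). Three consequences carry the proof.

  \<^item> Differentiability: stability is an open condition and discounted sums are Lipschitz in the
    dynamics (\<open>discounted_form_perturbation\<close>). So the derivative in direction \<open>h\<close> is the expectation of
    \<open>\<Sum>\<^sub>t 2 \<gamma>\<^sup>t E z\<^sub>t \<bullet> L h z\<^sub>t\<close> along the trajectory of \<open>p\<close> itself, with a remainder of second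
    order (\<open>J_has_derivative\<close>).

  \<^item> The gradient is large where \<open>E\<close> is: there is a direction \<open>h\<close> with \<open>L h z = E z\<close> on all states that
    occur. The stage \<open>t = 0\<close> alone contributes the expectation of \<open>2 |E (x\<^sub>0, xs)|\<^sup>2\<close>, which controls all
    coefficients of the affine function \<open>x \<mapsto> E (x, xs)\<close> because the normal distribution is not
    concentrated on a hyperplane (\<open>J_deriv_ascent_ge\<close>).

  \<^item> The excess cost is small where \<open>E\<close> is: completing the square, \<open>p\<close> exceeds any competitor by at
    most the discounted sum of \<open>|E z\<^sub>t|\<^sup>2\<close> along the competitor's trajectory, divided by the least
    eigenvalue of \<open>R\<close>. The competitor's own cost bounds its trajectory (\<open>J_le_competitor\<close>). Taking the
    infimum over all competitors gives a constant in terms of the optimal cost (\<open>J_le_optimal\<close>).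

  The hypothesis on the spectral radius enters only through the growth of powers of \<open>A + B K\<close>
  (\<open>orbit_bounded_if_spec_radius_less\<close>).
\<close>

section \<open>Discounted quadratic sums along linear dynamics\<close>

text \<open>
  Summability is required pointwise only. In finite dimension this already gives uniform bounds,
  because the sums below are bilinear in the initial states and bilinear maps are bounded.
\<close>
definition mean_square_stable :: "real \<Rightarrow> ('z::euclidean_space \<Rightarrow> 'z) \<Rightarrow> bool" where
  "mean_square_stable \<gamma> F \<longleftrightarrow> linear F \<and> (\<forall>z. summable (\<lambda>t. \<gamma> ^ t * (norm ((F ^^ t) z))\<^sup>2))"

text \<open>
  For stable \<open>F\<close> this is the solution \<open>P\<close> of the discrete Lyapunov equation
  \<open>P(z, w) = s(z, w) + \<gamma> P(F z, F w)\<close>, given as a series instead of a matrix.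
\<close>
definition discounted_form ::
  "real \<Rightarrow> ('z \<Rightarrow> 'z) \<Rightarrow> ('z \<Rightarrow> 'z \<Rightarrow> real) \<Rightarrow> 'z \<Rightarrow> 'z \<Rightarrow> real" where
  "discounted_form \<gamma> F s z w = (\<Sum>t. \<gamma> ^ t * s ((F ^^ t) z) ((F ^^ t) w))"

lemma linear_funpow: "linear F \<Longrightarrow> linear (F ^^ t)" for F :: "'a::real_vector \<Rightarrow> 'a"
proof (induction t)
  case 0
  show ?case by (simp add: linear_id id_def linear_ident)
next
  case (Suc t)
  then show ?case using linear_compose[of "F ^^ t" F] by (simp add: o_def)
qed

lemma abs_mult_le_mean_squares: "a * b \<le> (a\<^sup>2 + b\<^sup>2) / 2" for a b :: real
  using sum_squares_bound[of a b] by (simp add: field_simps)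

lemma summable_discounted_form:
  assumes "mean_square_stable \<gamma> F" "bilinear s" "0 < \<gamma>"
  shows "summable (\<lambda>t. \<gamma> ^ t * s ((F ^^ t) z) ((F ^^ t) w))"
proof -
  obtain K where K: "0 < K" "\<And>z w. norm (s z w) \<le> K * norm z * norm w"
    using bilinear_bounded_pos[OF assms(2)] by metis
  have "summable (\<lambda>t. K * (\<gamma> ^ t * (norm ((F ^^ t) z))\<^sup>2 + \<gamma> ^ t * (norm ((F ^^ t) w))\<^sup>2))"
    using assms(1) unfolding mean_square_stable_def by (intro summable_mult summable_add) auto
  then show ?thesis
  proof (rule summable_comparison_test'[where N = 0])
    fix t
    let ?a = "norm ((F ^^ t) z)" and ?b = "norm ((F ^^ t) w)"
    have "norm (s ((F ^^ t) z) ((F ^^ t) w)) \<le> K * (?a * ?b)"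
      using K(2) by (simp add: mult.assoc)
    also have "\<dots> \<le> K * (?a\<^sup>2 + ?b\<^sup>2)"
      using K(1) abs_mult_le_mean_squares[of ?a ?b] sum_power2_ge_zero[of ?a ?b]
      by (intro mult_left_mono order_trans[OF abs_mult_le_mean_squares]) auto
    finally have "\<gamma> ^ t * norm (s ((F ^^ t) z) ((F ^^ t) w)) \<le> \<gamma> ^ t * (K * (?a\<^sup>2 + ?b\<^sup>2))"
      using assms(3) by (intro mult_left_mono) auto
    then show "norm (\<gamma> ^ t * s ((F ^^ t) z) ((F ^^ t) w)) \<le> K * (\<gamma> ^ t * ?a\<^sup>2 + \<gamma> ^ t * ?b\<^sup>2)"
      using assms(3) by (simp add: abs_mult algebra_simps)
  qed
qed

lemma bilinear_discounted_form:
  assumes "mean_square_stable \<gamma> F" "bilinear s" "0 < \<gamma>"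
  shows "bilinear (discounted_form \<gamma> F s)"
proof -
  note sm = summable_discounted_form[OF assms]
  have l: "linear (F ^^ t)" for t
    using assms(1) by (simp add: mean_square_stable_def linear_funpow)
  show ?thesis
    unfolding bilinear_def linear_iff discounted_form_def
    by (auto simp: linear_add[OF l] linear_scale[OF l] bilinear_ladd[OF assms(2)]
        bilinear_radd[OF assms(2)] bilinear_lmul[OF assms(2)] bilinear_rmul[OF assms(2)]
        distrib_left suminf_add[OF sm sm] mult.left_commute suminf_mult[OF sm])
qed

lemma discounted_form_unfold:
  assumes "mean_square_stable \<gamma> F" "bilinear s" "0 < \<gamma>"
  shows "discounted_form \<gamma> F s z w = s z w + \<gamma> * discounted_form \<gamma> F s (F z) (F w)"
proof -
  note sm = summable_discounted_form[OF assms]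
  have "(\<Sum>t. \<gamma> ^ Suc t * s ((F ^^ Suc t) z) ((F ^^ Suc t) w)) = discounted_form \<gamma> F s z w - s z w"
    using suminf_split_head[OF sm, of z w] by (simp add: discounted_form_def)
  moreover have "(\<Sum>t. \<gamma> ^ Suc t * s ((F ^^ Suc t) z) ((F ^^ Suc t) w)) = \<gamma> * discounted_form \<gamma> F s (F z) (F w)"
    using suminf_mult[OF sm, of \<gamma> "F z" "F w"]
    by (simp add: discounted_form_def funpow_swap1 mult.assoc)
  ultimately show ?thesis by simp
qed

text \<open>
  The trajectory here is that of another map \<open>G\<close>. Running \<open>G\<close> and evaluating the solution \<open>P\<close> of
  the Lyapunov equation of \<open>F\<close> gives an exact identity: the two dynamics are compared one step at a
  time, and their difference enters only through \<open>P(G z, G z) - P(F z, F z)\<close>.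
\<close>
lemma discounted_form_telescope:
  assumes "mean_square_stable \<gamma> F" "bilinear s" "0 < \<gamma>"
  defines "P \<equiv> discounted_form \<gamma> F s"
  shows "(\<Sum>t<T. \<gamma> ^ t * s ((G ^^ t) z) ((G ^^ t) z)) =
    P z z - \<gamma> ^ T * P ((G ^^ T) z) ((G ^^ T) z)
    + (\<Sum>t<T. \<gamma> ^ Suc t * (P (G ((G ^^ t) z)) (G ((G ^^ t) z)) - P (F ((G ^^ t) z)) (F ((G ^^ t) z))))"
proof (induction T)
  case (Suc T)
  show ?case
    unfolding sum.lessThan_Suc Suc.IH
    using discounted_form_unfold[OF assms(1-3), of "(G ^^ T) z" "(G ^^ T) z"]
    by (simp add: P_def algebra_simps)
qed simp

lemma bilinear_inner: "bilinear (inner :: 'a::euclidean_space \<Rightarrow> 'a \<Rightarrow> real)"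
  by (simp add: bilinear_def linear_iff inner_add_left inner_add_right)

lemma form_bound_nonneg:
  fixes s :: "'z::euclidean_space \<Rightarrow> 'z \<Rightarrow> real"
  assumes "\<And>z w. \<bar>s z w\<bar> \<le> K * norm z * norm w"
  shows "0 \<le> K"
proof -
  obtain b :: 'z where "b \<in> Basis" using nonempty_Basis by blast
  then show ?thesis using order_trans[OF abs_ge_zero assms[of b b]] by simp
qed

text \<open>
  The point is that one constant serves all forms \<open>s\<close>. For unit initial
  vectors the bound \<open>\<bar>s(a, b)\<bar> \<le> K (|a|\<^sup>2 + |b|\<^sup>2) / 2\<close>, applied along the two orbits, reduces the claim to
  the form of the inner product; bilinearity then scales it to all vectors.
\<close>
lemma discounted_form_uniform_bound:
  fixes F :: "'z::euclidean_space \<Rightarrow> 'z"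
  assumes st: "mean_square_stable \<gamma> F" and "0 < \<gamma>"
  obtains C where "0 < C"
    "\<And>s K z w. bilinear s \<Longrightarrow> (\<And>z w. \<bar>s z w\<bar> \<le> K * norm z * norm w) \<Longrightarrow>
       \<bar>discounted_form \<gamma> F s z w\<bar> \<le> C * K * norm z * norm w"
proof -
  let ?W = "discounted_form \<gamma> F (\<bullet>)"
  have bW: "bilinear ?W" by (intro bilinear_discounted_form st bilinear_inner assms)
  obtain C where C: "0 < C" "\<And>z w. norm (?W z w) \<le> C * norm z * norm w"
    using bilinear_bounded_pos[OF bW] by metis
  have "\<bar>discounted_form \<gamma> F s z w\<bar> \<le> C * K * norm z * norm w"
    if s: "bilinear s" and K: "\<And>z w. \<bar>s z w\<bar> \<le> K * norm z * norm w" for s K z w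
  proof -
    note sm = summable_discounted_form[OF st _ \<open>0 < \<gamma>\<close>]
    have bP: "bilinear (discounted_form \<gamma> F s)" by (intro bilinear_discounted_form st s assms)
    have K0: "0 \<le> K" by (rule form_bound_nonneg) (use K in blast)
    have unit: "\<bar>discounted_form \<gamma> F s u v\<bar> \<le> C * K" if "norm u = 1" "norm v = 1" for u v
    proof -
      have nn: "\<gamma> ^ t * \<bar>s ((F ^^ t) u) ((F ^^ t) v)\<bar>
          \<le> K / 2 * (\<gamma> ^ t * ((F ^^ t) u \<bullet> (F ^^ t) u) + \<gamma> ^ t * ((F ^^ t) v \<bullet> (F ^^ t) v))" for t
      proof -
        let ?a = "norm ((F ^^ t) u)" and ?b = "norm ((F ^^ t) v)"
        have "\<bar>s ((F ^^ t) u) ((F ^^ t) v)\<bar> \<le> K * (?a * ?b)"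
          using K by (simp add: mult.assoc)
        also have "\<dots> \<le> K * ((?a\<^sup>2 + ?b\<^sup>2) / 2)"
          using K0 abs_mult_le_mean_squares[of ?a ?b] by (intro mult_left_mono)
        finally have "\<gamma> ^ t * \<bar>s ((F ^^ t) u) ((F ^^ t) v)\<bar> \<le> \<gamma> ^ t * (K * ((?a\<^sup>2 + ?b\<^sup>2) / 2))"
          using assms by (intro mult_left_mono) auto
        then show ?thesis by (simp add: power2_norm_eq_inner algebra_simps)
      qed
      have sm2: "summable (\<lambda>t. K / 2 * (\<gamma> ^ t * ((F ^^ t) u \<bullet> (F ^^ t) u) + \<gamma> ^ t * ((F ^^ t) v \<bullet> (F ^^ t) v)))"
        by (intro summable_mult summable_add sm bilinear_inner)
      have "\<bar>discounted_form \<gamma> F s u v\<bar>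
          \<le> (\<Sum>t. K / 2 * (\<gamma> ^ t * ((F ^^ t) u \<bullet> (F ^^ t) u) + \<gamma> ^ t * ((F ^^ t) v \<bullet> (F ^^ t) v)))"
        unfolding discounted_form_def
        using norm_suminf_le[OF _ sm2, of "\<lambda>t. \<gamma> ^ t * s ((F ^^ t) u) ((F ^^ t) v)"] nn assms
        by (simp add: abs_mult)
      also have "\<dots> = K / 2 * (?W u u + ?W v v)"
        unfolding discounted_form_def
        by (simp only: suminf_mult[OF summable_add[OF sm[OF bilinear_inner] sm[OF bilinear_inner]]]
            suminf_add[OF sm[OF bilinear_inner] sm[OF bilinear_inner]])
      also have "\<dots> \<le> K / 2 * (C + C)"
        using C(2)[of u u] C(2)[of v v] that K0 by (intro mult_left_mono add_mono) auto
      finally show ?thesis by (simp add: mult.commute)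
    qed
    show ?thesis
    proof (cases "z = 0 \<or> w = 0")
      case True
      then show ?thesis using bilinear_lzero[OF bP] bilinear_rzero[OF bP] by auto
    next
      case False
      have "discounted_form \<gamma> F s z w = norm z * norm w * discounted_form \<gamma> F s (z /\<^sub>R norm z) (w /\<^sub>R norm w)"
        using False by (simp add: bilinear_lmul[OF bP] bilinear_rmul[OF bP] field_simps)
      then have "\<bar>discounted_form \<gamma> F s z w\<bar>
          = norm z * norm w * \<bar>discounted_form \<gamma> F s (z /\<^sub>R norm z) (w /\<^sub>R norm w)\<bar>"
        by (simp add: abs_mult)
      also have "\<dots> \<le> norm z * norm w * (C * K)"
        using False by (intro mult_left_mono unit) auto
      finally show ?thesis by (simp add: mult_ac)
    qed
  qed
  with C(1) that show ?thesis by blast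
qed

lemma summable_square_imp_discounted_null:
  assumes "bilinear (P :: 'z::euclidean_space \<Rightarrow> 'z \<Rightarrow> real)" "0 < \<gamma>"
    and "summable (\<lambda>t. \<gamma> ^ t * (norm (x t))\<^sup>2)"
  shows "(\<lambda>t. \<gamma> ^ t * P (x t) (x t)) \<longlonglongrightarrow> 0"
proof -
  obtain K where K: "0 < K" "\<And>z w. norm (P z w) \<le> K * norm z * norm w"
    using bilinear_bounded_pos[OF assms(1)] by metis
  have "(\<lambda>t. K * (\<gamma> ^ t * (norm (x t))\<^sup>2)) \<longlonglongrightarrow> K * 0"
    by (intro tendsto_intros summable_LIMSEQ_zero assms)
  moreover have "norm (\<gamma> ^ t * P (x t) (x t)) \<le> K * (\<gamma> ^ t * (norm (x t))\<^sup>2)" for t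
    using mult_left_mono[OF K(2)[of "x t" "x t"], of "\<gamma> ^ t"] assms(2)
    by (simp add: abs_mult power2_eq_square mult_ac)
  ultimately show ?thesis
    by (auto intro: Lim_null_comparison[where g = "\<lambda>t. K * (\<gamma> ^ t * (norm (x t))\<^sup>2)"])
qed

lemma bilinear_diff_same:
  assumes "bilinear P"
  shows "P a a - P b b = P (a - b) a + P b (a - b)"
  by (simp add: bilinear_lsub[OF assms] bilinear_rsub[OF assms])

text \<open>
  Mean-square stability is an open condition, and discounted sums depend on the map in a Lipschitz
  way. With \<open>W\<close> the discounted form of the inner product, \<open>\<gamma> W(F z, F z) = W(z, z) - |z|\<^sup>2\<close>; if \<open>G\<close> is
  close to \<open>F\<close>, then still \<open>\<gamma> W(G z, G z) \<le> W(z, z) - |z|\<^sup>2 / 2\<close>, and telescoping bounds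
  \<open>\<Sum>\<^sub>t \<gamma>\<^sup>t |G\<^sup>t z|\<^sup>2\<close> by \<open>2 W(z, z)\<close>. The same telescoping with the form of \<open>s\<close> then
  bounds the difference of the two sums.
\<close>
lemma discounted_form_perturbation:
  fixes F :: "'z::euclidean_space \<Rightarrow> 'z"
  assumes st: "mean_square_stable \<gamma> F" and "0 < \<gamma>"
  obtains \<eta> C where "0 < \<eta>" "0 < C"
    "\<forall>G d. linear G \<longrightarrow> 0 \<le> d \<longrightarrow> d \<le> \<eta> \<longrightarrow> (\<forall>z. norm (G z - F z) \<le> d * norm z) \<longrightarrow>
      mean_square_stable \<gamma> G \<and>
      (\<forall>z. (\<Sum>t. \<gamma> ^ t * (norm ((G ^^ t) z))\<^sup>2) \<le> C * (norm z)\<^sup>2) \<and>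
      (\<forall>s K z. bilinear s \<longrightarrow> (\<forall>z w. \<bar>s z w\<bar> \<le> K * norm z * norm w) \<longrightarrow>
         \<bar>discounted_form \<gamma> G s z z - discounted_form \<gamma> F s z z\<bar> \<le> C * K * d * (norm z)\<^sup>2)"
proof -
  have linF: "linear F" using st by (simp add: mean_square_stable_def)
  obtain KF where KF: "0 < KF" "\<And>z. norm (F z) \<le> KF * norm z"
    using linear_bounded_pos[OF linF] by metis
  obtain C where C: "0 < C" "\<And>s K z w. bilinear s \<Longrightarrow> (\<And>z w. \<bar>s z w\<bar> \<le> K * norm z * norm w) \<Longrightarrow>
       \<bar>discounted_form \<gamma> F s z w\<bar> \<le> C * K * norm z * norm w"
    using discounted_form_uniform_bound[OF st \<open>0 < \<gamma>\<close>] by metis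
  define m where "m = \<gamma> * (C * (2 * KF + 1))"
  have m: "0 < m" using KF C \<open>0 < \<gamma>\<close> by (simp add: m_def)
  \<comment> \<open>The bound 1 keeps \<open>|G|\<close> below \<open>KF + 1\<close>; the other one makes a perturbation cost at most \<open>|z|\<^sup>2 / 2\<close>.\<close>
  define \<eta> where "\<eta> = min 1 (1 / (2 * m))"
  have \<eta>: "0 < \<eta>" "\<eta> \<le> 1" "m * \<eta> \<le> 1 / 2"
    using m by (auto simp: \<eta>_def min_def field_simps)
  have main: "mean_square_stable \<gamma> G"
    "(\<Sum>t. \<gamma> ^ t * (norm ((G ^^ t) z))\<^sup>2) \<le> 2 * C * (norm z)\<^sup>2"
    "bilinear s \<Longrightarrow> (\<And>z w. \<bar>s z w\<bar> \<le> K * norm z * norm w) \<Longrightarrow>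
         \<bar>discounted_form \<gamma> G s z z - discounted_form \<gamma> F s z z\<bar> \<le> m * (2 * C) * K * d * (norm z)\<^sup>2"
    if G: "linear G" and d: "0 \<le> d" "d \<le> \<eta>" and GF: "\<And>z. norm (G z - F z) \<le> d * norm z"
    for G :: "'z \<Rightarrow> 'z" and d z s K
  proof -
    have KG: "norm (G z) \<le> (KF + 1) * norm z" for z
    proof -
      have "norm (G z) \<le> norm (F z) + norm (G z - F z)" by (rule norm_triangle_sub)
      also have "\<dots> \<le> KF * norm z + 1 * norm z"
        using d \<eta>(2) by (intro add_mono KF order_trans[OF GF] mult_right_mono) auto
      finally show ?thesis by (simp add: algebra_simps)
    qed
    have step: "\<gamma> * \<bar>discounted_form \<gamma> F s (G z) (G z) - discounted_form \<gamma> F s (F z) (F z)\<bar>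
        \<le> m * K * d * (norm z)\<^sup>2"
      if s: "bilinear s" and K: "\<And>z w. \<bar>s z w\<bar> \<le> K * norm z * norm w" for s K z
    proof -
      have K0: "0 \<le> K" by (rule form_bound_nonneg) (use K in blast)
      let ?P = "discounted_form \<gamma> F s"
      have bP: "bilinear ?P" by (intro bilinear_discounted_form st s \<open>0 < \<gamma>\<close>)
      have "\<bar>?P (G z) (G z) - ?P (F z) (F z)\<bar> \<le> \<bar>?P (G z - F z) (G z)\<bar> + \<bar>?P (F z) (G z - F z)\<bar>"
        unfolding bilinear_diff_same[OF bP] by (rule abs_triangle_ineq)
      also have "\<dots> \<le> C * K * (d * norm z) * ((KF + 1) * norm z) + C * K * (KF * norm z) * (d * norm z)"
        using C(1) K0 d KF(1)
        by (intro add_mono order_trans[OF C(2)[OF s K]] mult_mono GF KG KF) auto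
      also have "\<dots> = C * (2 * KF + 1) * K * d * (norm z)\<^sup>2"
        by (simp add: algebra_simps power2_eq_square)
      finally have "\<gamma> * \<bar>?P (G z) (G z) - ?P (F z) (F z)\<bar> \<le> \<gamma> * (C * (2 * KF + 1) * K * d * (norm z)\<^sup>2)"
        using \<open>0 < \<gamma>\<close> by (intro mult_left_mono) auto
      then show ?thesis by (simp add: m_def mult_ac)
    qed
    let ?W = "discounted_form \<gamma> F (\<bullet>)"
    have inner_bd: "\<And>z w :: 'z. \<bar>z \<bullet> w\<bar> \<le> 1 * norm z * norm w"
      using Cauchy_Schwarz_ineq2 by simp
    have W0: "0 \<le> ?W z z" for z
      unfolding discounted_form_def using \<open>0 < \<gamma>\<close>
      by (intro suminf_nonneg summable_discounted_form st bilinear_inner) auto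
    have part: "(\<Sum>t<T. \<gamma> ^ t * (norm ((G ^^ t) z))\<^sup>2) \<le> 2 * C * (norm z)\<^sup>2" for T z
    proof -
      let ?S = "\<Sum>t<T. \<gamma> ^ t * (norm ((G ^^ t) z))\<^sup>2"
      have "?S = ?W z z - \<gamma> ^ T * ?W ((G ^^ T) z) ((G ^^ T) z)
        + (\<Sum>t<T. \<gamma> ^ Suc t * (?W (G ((G ^^ t) z)) (G ((G ^^ t) z)) - ?W (F ((G ^^ t) z)) (F ((G ^^ t) z))))"
        using discounted_form_telescope[OF st bilinear_inner \<open>0 < \<gamma>\<close>, of G z T]
        by (simp add: power2_norm_eq_inner)
      also have "\<dots> \<le> C * (norm z)\<^sup>2 - 0 + (\<Sum>t<T. \<gamma> ^ t * ((norm ((G ^^ t) z))\<^sup>2 / 2))"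
      proof (intro add_mono diff_mono sum_mono)
        show "?W z z \<le> C * (norm z)\<^sup>2"
          using C(2)[OF bilinear_inner inner_bd, of z z] by (simp add: power2_eq_square mult_ac)
        show "0 \<le> \<gamma> ^ T * ?W ((G ^^ T) z) ((G ^^ T) z)" using W0 \<open>0 < \<gamma>\<close> by simp
        fix t
        let ?z = "(G ^^ t) z"
        have "\<gamma> * (?W (G ?z) (G ?z) - ?W (F ?z) (F ?z)) \<le> m * d * (norm ?z)\<^sup>2"
          using step[OF bilinear_inner inner_bd, of ?z] \<open>0 < \<gamma>\<close>
            mult_left_mono[OF abs_ge_self[of "?W (G ?z) (G ?z) - ?W (F ?z) (F ?z)"], of \<gamma>] by linarith
        also have "\<dots> \<le> 1 / 2 * (norm ?z)\<^sup>2"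
        proof (intro mult_right_mono)
          show "m * d \<le> 1 / 2" using d \<eta> m mult_left_mono[of d \<eta> m] by linarith
        qed auto
        finally have "\<gamma> ^ t * (\<gamma> * (?W (G ?z) (G ?z) - ?W (F ?z) (F ?z))) \<le> \<gamma> ^ t * ((norm ?z)\<^sup>2 / 2)"
          using \<open>0 < \<gamma>\<close> by (intro mult_left_mono) auto
        then show "\<gamma> ^ Suc t * (?W (G ?z) (G ?z) - ?W (F ?z) (F ?z)) \<le> \<gamma> ^ t * ((norm ?z)\<^sup>2 / 2)"
          by (simp add: mult_ac)
      qed
      also have "\<dots> = C * (norm z)\<^sup>2 + ?S / 2" by (simp add: sum_divide_distrib)
      finally show ?thesis by simp
    qed
    have smG: "summable (\<lambda>t. \<gamma> ^ t * (norm ((G ^^ t) z))\<^sup>2)" for z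
      by (rule bounded_imp_summable[where B = "2 * C * (norm z)\<^sup>2"])
        (use \<open>0 < \<gamma>\<close> part[where T = "Suc _"] in \<open>auto simp: lessThan_Suc_atMost\<close>)
    then show stG: "mean_square_stable \<gamma> G" using G by (simp add: mean_square_stable_def)
    show sumG: "(\<Sum>t. \<gamma> ^ t * (norm ((G ^^ t) z))\<^sup>2) \<le> 2 * C * (norm z)\<^sup>2" for z
      by (rule suminf_le_const[OF smG part])
    show "\<bar>discounted_form \<gamma> G s z z - discounted_form \<gamma> F s z z\<bar> \<le> m * (2 * C) * K * d * (norm z)\<^sup>2"
      if s: "bilinear s" and K: "\<And>z w. \<bar>s z w\<bar> \<le> K * norm z * norm w" for s K
    proof -
      have K0: "0 \<le> K" by (rule form_bound_nonneg) (use K in blast)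
      let ?P = "discounted_form \<gamma> F s"
      let ?r = "\<lambda>t. \<gamma> ^ Suc t * (?P (G ((G ^^ t) z)) (G ((G ^^ t) z)) - ?P (F ((G ^^ t) z)) (F ((G ^^ t) z)))"
      have bP: "bilinear ?P" by (intro bilinear_discounted_form st s \<open>0 < \<gamma>\<close>)
      have "(\<lambda>T. \<Sum>t<T. \<gamma> ^ t * s ((G ^^ t) z) ((G ^^ t) z)) \<longlonglongrightarrow> discounted_form \<gamma> G s z z"
        unfolding discounted_form_def
        by (intro summable_LIMSEQ summable_discounted_form stG s \<open>0 < \<gamma>\<close>)
      then have "(\<lambda>T. (\<Sum>t<T. \<gamma> ^ t * s ((G ^^ t) z) ((G ^^ t) z)) - ?P z z + \<gamma> ^ T * ?P ((G ^^ T) z) ((G ^^ T) z))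
          \<longlonglongrightarrow> discounted_form \<gamma> G s z z - ?P z z + 0"
        by (intro tendsto_add tendsto_diff tendsto_const
            summable_square_imp_discounted_null[OF bP \<open>0 < \<gamma>\<close> smG])
      then have "(\<lambda>T. \<Sum>t<T. ?r t) \<longlonglongrightarrow> discounted_form \<gamma> G s z z - ?P z z"
        using discounted_form_telescope[OF st s \<open>0 < \<gamma>\<close>, of G z] by simp
      then have sums: "?r sums (discounted_form \<gamma> G s z z - ?P z z)" by (simp add: sums_def)
      have rb: "norm (?r t) \<le> m * K * d * (\<gamma> ^ t * (norm ((G ^^ t) z))\<^sup>2)" for t
        using mult_left_mono[OF step[OF s K, of "(G ^^ t) z"], of "\<gamma> ^ t"] \<open>0 < \<gamma>\<close>
        by (simp add: abs_mult mult_ac)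
      have "norm (suminf ?r) \<le> (\<Sum>t. m * K * d * (\<gamma> ^ t * (norm ((G ^^ t) z))\<^sup>2))"
        by (intro norm_suminf_le rb summable_mult smG)
      also have "\<dots> = m * K * d * (\<Sum>t. \<gamma> ^ t * (norm ((G ^^ t) z))\<^sup>2)"
        by (intro suminf_mult smG)
      also have "\<dots> \<le> m * K * d * (2 * C * (norm z)\<^sup>2)"
        using m K0 d by (intro mult_left_mono sumG) auto
      finally show ?thesis using sums_unique[OF sums] by (simp add: mult_ac)
    qed
  qed
  define CC where "CC = max (2 * C) (m * (2 * C))"
  have CC: "0 < CC" "2 * C \<le> CC" "m * (2 * C) \<le> CC" using C(1) unfolding CC_def by linarith+
  show ?thesis
  proof (rule that[OF \<eta>(1) CC(1)], intro conjI allI impI)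
    fix G d assume G': "linear G" "0 \<le> d" "d \<le> \<eta>" "\<forall>z. norm (G z - F z) \<le> d * norm z"
    note G = G'(1-3) G'(4)[rule_format]
    show "mean_square_stable \<gamma> G" by (rule main(1)[OF G])
    show "(\<Sum>t. \<gamma> ^ t * (norm ((G ^^ t) z))\<^sup>2) \<le> CC * (norm z)\<^sup>2" for z
      by (rule order_trans[OF main(2)[OF G]]) (intro mult_right_mono CC, simp)
    fix s :: "'z \<Rightarrow> 'z \<Rightarrow> real" and K z assume s: "bilinear s" and K: "\<forall>z w. \<bar>s z w\<bar> \<le> K * norm z * norm w"
    have K0: "0 \<le> K" by (rule form_bound_nonneg) (use K in blast)
    have "\<bar>discounted_form \<gamma> G s z z - discounted_form \<gamma> F s z z\<bar> \<le> m * (2 * C) * (K * d * (norm z)\<^sup>2)"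
      using main(3)[OF G s K[rule_format]] by (simp add: mult.assoc)
    also have "\<dots> \<le> CC * (K * d * (norm z)\<^sup>2)"
      using K0 G(2) CC(3) by (intro mult_right_mono) simp_all
    finally show "\<bar>discounted_form \<gamma> G s z z - discounted_form \<gamma> F s z z\<bar> \<le> CC * K * d * (norm z)\<^sup>2"
      by (simp add: mult.assoc)
  qed
qed

section \<open>Linear-quadratic regulators in coordinate-free form\<close>

text \<open>
  A coordinate-free regulator problem: state \<open>z\<close>, input \<open>L p z\<close>, and a cost that is a quadratic form
  in state and input. The policy \<open>p\<close> enters bilinearly, so that it may range over a space of
  structured feedback gains. An affine problem fits in after adding coordinates to the state; its
  cost then degenerates in some directions, hence a positive semidefinite \<open>q\<close>.
\<close>
locale linear_quadratic =
  fixes A :: "'z::euclidean_space \<Rightarrow> 'z" and B :: "'u::euclidean_space \<Rightarrow> 'z"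
    and L :: "'p::euclidean_space \<Rightarrow> 'z \<Rightarrow> 'u"
    and q :: "'z \<Rightarrow> 'z \<Rightarrow> real" and R :: "'u \<Rightarrow> 'u \<Rightarrow> real" and \<gamma> r :: real
  assumes linear_A: "linear A" and linear_B: "linear B" and bilinear_L: "bilinear L"
    and bilinear_q: "bilinear q" and q_sym: "q z w = q w z" and q_nonneg: "0 \<le> q z z"
    and bilinear_R: "bilinear R" and R_sym: "R u v = R v u"
    and r_pos: "0 < r" and R_coercive: "r * (norm u)\<^sup>2 \<le> R u u"
    and \<gamma>_pos: "0 < \<gamma>"
begin

definition loop :: "'p \<Rightarrow> 'z \<Rightarrow> 'z" where
  "loop p z = A z + B (L p z)"

definition cost :: "'p \<Rightarrow> 'z \<Rightarrow> 'z \<Rightarrow> real" where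
  "cost p z w = q z w + R (L p z) (L p w)"

definition val :: "'p \<Rightarrow> 'z \<Rightarrow> 'z \<Rightarrow> real" where
  "val p = discounted_form \<gamma> (loop p) (cost p)"

text \<open>
  Half the gradient, at the input \<open>u = L p z\<close>, of the cost \<open>q(z, z) + R(u, u) + \<gamma> val(A z + B u)\<close> of
  applying \<open>u\<close> once and following \<open>p\<close> afterwards; \<open>input_hess\<close> is half the Hessian in \<open>u\<close>. For
  stable \<open>p\<close> the gradient vanishes for all \<open>z\<close> exactly when \<open>p\<close> satisfies the Bellman optimality equation.
\<close>
definition input_grad :: "'p \<Rightarrow> 'z \<Rightarrow> 'u" where
  "input_grad p z = (\<Sum>b\<in>Basis. (R (L p z) b + \<gamma> * val p (loop p z) (B b)) *\<^sub>R b)"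

definition input_hess :: "'p \<Rightarrow> 'u \<Rightarrow> 'u \<Rightarrow> real" where
  "input_hess p u v = R u v + \<gamma> * val p (B u) (B v)"

text \<open>
  Half the first-order change of the cost-to-go at state \<open>z = w\<close> when the input of one stage is moved
  by \<open>L h z\<close>; twice its discounted sum is the directional derivative of the value.
\<close>
definition dir_form :: "'p \<Rightarrow> 'p \<Rightarrow> 'z \<Rightarrow> 'z \<Rightarrow> real" where
  "dir_form p h z w = input_grad p z \<bullet> L h w"

definition val_deriv :: "'p \<Rightarrow> 'p \<Rightarrow> 'z \<Rightarrow> real" where
  "val_deriv p h z = 2 * discounted_form \<gamma> (loop p) (dir_form p h) z z"

lemmas L_simps = bilinear_ladd[OF bilinear_L] bilinear_radd[OF bilinear_L]
  bilinear_lmul[OF bilinear_L] bilinear_rmul[OF bilinear_L]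
lemmas q_simps = bilinear_ladd[OF bilinear_q] bilinear_radd[OF bilinear_q]
  bilinear_lmul[OF bilinear_q] bilinear_rmul[OF bilinear_q]
lemmas R_simps = bilinear_ladd[OF bilinear_R] bilinear_radd[OF bilinear_R]
  bilinear_lmul[OF bilinear_R] bilinear_rmul[OF bilinear_R]
lemmas AB_simps = linear_add[OF linear_A] linear_scale[OF linear_A]
  linear_add[OF linear_B] linear_scale[OF linear_B]

lemma linear_loop: "linear (loop p)"
  by (simp add: linear_iff loop_def L_simps AB_simps algebra_simps)

lemma bilinear_cost: "bilinear (cost p)"
  by (simp add: bilinear_def linear_iff cost_def L_simps q_simps R_simps algebra_simps)

lemma R_nonneg: "0 \<le> R u u"
  using r_pos by (intro order_trans[OF _ R_coercive]) simp

lemma cost_nonneg: "0 \<le> cost p z z"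
  by (simp add: cost_def q_nonneg R_nonneg)

lemma loop_add: "loop (p + h) z = loop p z + B (L h z)"
  by (simp add: loop_def L_simps AB_simps)

context
  fixes p assumes stable: "mean_square_stable \<gamma> (loop p)"
begin

lemma bilinear_val: "bilinear (val p)"
  unfolding val_def by (intro bilinear_discounted_form stable bilinear_cost \<gamma>_pos)

lemmas val_simps = bilinear_ladd[OF bilinear_val] bilinear_radd[OF bilinear_val]
  bilinear_lmul[OF bilinear_val] bilinear_rmul[OF bilinear_val]

lemma val_sym: "val p z w = val p w z"
  by (simp add: val_def discounted_form_def cost_def q_sym R_sym)

lemma val_nonneg: "0 \<le> val p z z"
  unfolding val_def discounted_form_def using \<gamma>_pos
  by (intro suminf_nonneg summable_discounted_form stable bilinear_cost) (auto simp: cost_nonneg)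

lemma val_unfold: "val p z z = cost p z z + \<gamma> * val p (loop p z) (loop p z)"
  unfolding val_def by (rule discounted_form_unfold[OF stable bilinear_cost \<gamma>_pos])

lemma bilinear_input_hess: "bilinear (input_hess p)"
  by (simp add: bilinear_def linear_iff input_hess_def R_simps val_simps AB_simps algebra_simps)

lemma input_hess_coercive: "r * (norm u)\<^sup>2 \<le> input_hess p u u"
  using R_coercive[of u] val_nonneg[of "B u"] \<gamma>_pos by (simp add: input_hess_def add_increasing2)

lemma input_grad_inner: "input_grad p z \<bullet> u = R (L p z) u + \<gamma> * val p (loop p z) (B u)"
proof -
  define f where "f u = R (L p z) u + \<gamma> * val p (loop p z) (B u)" for u
  have f: "linear f"
    by (simp add: linear_iff f_def R_simps val_simps AB_simps algebra_simps)
  have "f u = f (\<Sum>b\<in>Basis. (u \<bullet> b) *\<^sub>R b)" by (simp add: euclidean_representation)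
  also have "\<dots> = (\<Sum>b\<in>Basis. (u \<bullet> b) * f b)" by (simp add: linear_sum[OF f] linear_scale[OF f])
  also have "\<dots> = input_grad p z \<bullet> u"
    by (simp add: input_grad_def inner_sum_left f_def[symmetric] inner_commute[of u] mult.commute)
  finally show ?thesis by (simp add: f_def)
qed

lemma linear_input_grad: "linear (input_grad p)"
proof (rule linearI)
  show "input_grad p (z + w) = input_grad p z + input_grad p w" for z w
    by (rule vector_eq_ldot[THEN iffD1])
      (auto simp: inner_add_left inner_commute[where y = "input_grad p _"] inner_add_right input_grad_inner
        linear_add[OF linear_loop] L_simps R_simps val_simps algebra_simps)
  show "input_grad p (c *\<^sub>R z) = c *\<^sub>R input_grad p z" for c z
    by (rule vector_eq_ldot[THEN iffD1])
      (auto simp: inner_commute[where y = "input_grad p _"] input_grad_inner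
        linear_scale[OF linear_loop] L_simps R_simps val_simps algebra_simps)
qed

text \<open>
  One step under \<open>p + h\<close> followed by \<open>p\<close>: the dependence on the input is quadratic, so this second-order
  expansion is exact.
\<close>
lemma bellman_perturbed:
  "cost (p + h) z z + \<gamma> * val p (loop (p + h) z) (loop (p + h) z)
    = val p z z + 2 * (input_grad p z \<bullet> L h z) + input_hess p (L h z) (L h z)"
  unfolding val_unfold[of z] input_grad_inner input_hess_def loop_add cost_def L_simps R_simps val_simps
  using R_sym[of "L p z" "L h z"] val_sym[of "loop p z" "B (L h z)"]
  by (simp add: algebra_simps)

text \<open>
  The one-step expansion telescopes along the trajectory of \<open>p + h\<close>.
\<close>
lemma performance_difference:
  fixes h z T
  defines "G \<equiv> loop (p + h)"
  shows "(\<Sum>t<T. \<gamma> ^ t * cost (p + h) ((G ^^ t) z) ((G ^^ t) z)) =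
    val p z z - \<gamma> ^ T * val p ((G ^^ T) z) ((G ^^ T) z)
    + (\<Sum>t<T. \<gamma> ^ t * (2 * (input_grad p ((G ^^ t) z) \<bullet> L h ((G ^^ t) z))
        + input_hess p (L h ((G ^^ t) z)) (L h ((G ^^ t) z))))"
proof (induction T)
  case (Suc T)
  have "\<gamma> ^ T * (cost (p + h) ((G ^^ T) z) ((G ^^ T) z) + \<gamma> * val p (G ((G ^^ T) z)) (G ((G ^^ T) z)))
      = \<gamma> ^ T * (val p ((G ^^ T) z) ((G ^^ T) z) + 2 * (input_grad p ((G ^^ T) z) \<bullet> L h ((G ^^ T) z))
        + input_hess p (L h ((G ^^ T) z)) (L h ((G ^^ T) z)))"
    using bellman_perturbed[of h "(G ^^ T) z"] by (simp add: G_def)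
  with Suc show ?case by (simp add: algebra_simps)
qed simp

text \<open>
  Completing the square in the performance difference: no change of input can gain more than
  \<open>|input_grad|\<^sup>2 / r\<close> per step. Square summability is asked of the single trajectory from \<open>z\<close>, so that
  unstable competitors \<open>p + h\<close> of finite cost are covered.
\<close>
lemma val_le_cost_plus_gradient:
  fixes h z
  defines "G \<equiv> loop (p + h)"
  assumes sm: "summable (\<lambda>t. \<gamma> ^ t * (norm ((G ^^ t) z))\<^sup>2)"
  shows "val p z z \<le> (\<Sum>t. \<gamma> ^ t * cost (p + h) ((G ^^ t) z) ((G ^^ t) z))
    + (\<Sum>t. \<gamma> ^ t * (norm (input_grad p ((G ^^ t) z)))\<^sup>2) / r"
proof -
  have square_bounded: "summable (\<lambda>t. \<gamma> ^ t * s ((G ^^ t) z) ((G ^^ t) z))"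
    if s: "bilinear s" for s :: "'z \<Rightarrow> 'z \<Rightarrow> real"
  proof -
    obtain K where K: "0 < K" "\<And>z w. norm (s z w) \<le> K * norm z * norm w"
      using bilinear_bounded_pos[OF s] by metis
    show ?thesis
    proof (rule summable_comparison_test'[where N = 0])
      show "summable (\<lambda>t. K * (\<gamma> ^ t * (norm ((G ^^ t) z))\<^sup>2))" by (intro summable_mult sm)
      show "norm (\<gamma> ^ t * s ((G ^^ t) z) ((G ^^ t) z)) \<le> K * (\<gamma> ^ t * (norm ((G ^^ t) z))\<^sup>2)" for t
        using mult_left_mono[OF K(2)[of "(G ^^ t) z" "(G ^^ t) z"], of "\<gamma> ^ t"] \<gamma>_pos
        by (simp add: abs_mult power2_eq_square mult_ac)
    qed
  qed
  have sg: "summable (\<lambda>t. \<gamma> ^ t * (norm (input_grad p ((G ^^ t) z)))\<^sup>2)"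
    unfolding power2_norm_eq_inner
    by (rule square_bounded) (simp add: bilinear_def linear_iff linear_add[OF linear_input_grad]
        linear_scale[OF linear_input_grad] inner_add_left inner_add_right)
  have sc: "summable (\<lambda>t. \<gamma> ^ t * cost (p + h) ((G ^^ t) z) ((G ^^ t) z))"
    by (rule square_bounded[OF bilinear_cost])
  have fin: "val p z z - \<gamma> ^ T * val p ((G ^^ T) z) ((G ^^ T) z)
      \<le> (\<Sum>t<T. \<gamma> ^ t * cost (p + h) ((G ^^ t) z) ((G ^^ t) z))
        + (\<Sum>t<T. \<gamma> ^ t * (norm (input_grad p ((G ^^ t) z)))\<^sup>2) / r" for T
  proof -
    have "- ((norm e)\<^sup>2 / r) \<le> 2 * (e \<bullet> d) + input_hess p d d" for e d
    proof -
      have "0 \<le> (norm (e + r *\<^sub>R d))\<^sup>2" by simp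
      also have "\<dots> = r * ((norm e)\<^sup>2 / r + 2 * (e \<bullet> d) + r * (norm d)\<^sup>2)"
        using r_pos unfolding power2_norm_eq_inner
        by (simp add: inner_add_left inner_add_right inner_commute algebra_simps power2_eq_square)
      finally have "0 \<le> (norm e)\<^sup>2 / r + 2 * (e \<bullet> d) + r * (norm d)\<^sup>2"
        using r_pos by (simp add: zero_le_mult_iff)
      then show ?thesis using input_hess_coercive[of d] by linarith
    qed
    then have "(\<Sum>t<T. \<gamma> ^ t * - ((norm (input_grad p ((G ^^ t) z)))\<^sup>2 / r))
      \<le> (\<Sum>t<T. \<gamma> ^ t * (2 * (input_grad p ((G ^^ t) z) \<bullet> L h ((G ^^ t) z))
        + input_hess p (L h ((G ^^ t) z)) (L h ((G ^^ t) z))))"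
      using \<gamma>_pos by (intro sum_mono mult_left_mono) auto
    then show ?thesis
      using performance_difference[of h z T]
      by (simp add: G_def sum_negf sum_divide_distrib)
  qed
  have "(\<lambda>T. val p z z - \<gamma> ^ T * val p ((G ^^ T) z) ((G ^^ T) z)) \<longlonglongrightarrow> val p z z - 0"
    by (intro tendsto_diff tendsto_const summable_square_imp_discounted_null bilinear_val \<gamma>_pos sm)
  then show ?thesis
    using fin r_pos by (intro LIMSEQ_le[OF _ tendsto_add[OF summable_LIMSEQ[OF sc]
            tendsto_divide[OF summable_LIMSEQ[OF sg] tendsto_const]]]) auto
qed

lemma bilinear_dir_form: "bilinear (dir_form p h)"
  by (simp add: bilinear_def linear_iff dir_form_def linear_add[OF linear_input_grad]
        linear_scale[OF linear_input_grad] L_simps inner_add_left inner_add_right)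

text \<open>
  In the performance difference the terms linear in \<open>h\<close> are evaluated along the perturbed trajectory.
  Replacing it by the unperturbed one costs a second factor \<open>|h|\<close>, by Lipschitz dependence on the
  dynamics, so the remainder is of second order, with a bound that is uniform in the initial state.
\<close>
lemma val_has_derivative_bound:
  obtains \<eta> C where "0 < \<eta>" "0 < C"
    "\<And>h. norm h < \<eta> \<Longrightarrow> mean_square_stable \<gamma> (loop (p + h))"
    "\<And>h z. norm h < \<eta> \<Longrightarrow>
       \<bar>val (p + h) z z - val p z z - val_deriv p h z\<bar> \<le> C * (norm h)\<^sup>2 * (norm z)\<^sup>2"
proof -
  obtain KB where KB: "0 < KB" "\<And>u. norm (B u) \<le> KB * norm u"
    using linear_bounded_pos[OF linear_B] by metis
  obtain KL where KL: "0 < KL" "\<And>h z. norm (L h z) \<le> KL * norm h * norm z"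
    using bilinear_bounded_pos[OF bilinear_L] by metis
  obtain KE where KE: "0 < KE" "\<And>z. norm (input_grad p z) \<le> KE * norm z"
    using linear_bounded_pos[OF linear_input_grad] by metis
  obtain KH where KH: "0 < KH" "\<And>u v. norm (input_hess p u v) \<le> KH * norm u * norm v"
    using bilinear_bounded_pos[OF bilinear_input_hess] by metis
  obtain \<eta> C where \<eta>: "0 < \<eta>" "0 < C" and pert:
    "\<forall>G d. linear G \<longrightarrow> 0 \<le> d \<longrightarrow> d \<le> \<eta> \<longrightarrow> (\<forall>z. norm (G z - loop p z) \<le> d * norm z) \<longrightarrow>
      mean_square_stable \<gamma> G \<and>
      (\<forall>z. (\<Sum>t. \<gamma> ^ t * (norm ((G ^^ t) z))\<^sup>2) \<le> C * (norm z)\<^sup>2) \<and>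
      (\<forall>s K z. bilinear s \<longrightarrow> (\<forall>z w. \<bar>s z w\<bar> \<le> K * norm z * norm w) \<longrightarrow>
         \<bar>discounted_form \<gamma> G s z z - discounted_form \<gamma> (loop p) s z z\<bar> \<le> C * K * d * (norm z)\<^sup>2)"
    by (rule discounted_form_perturbation[OF stable \<gamma>_pos]) (rule that)
  have close: "norm (loop (p + h) z - loop p z) \<le> KB * KL * norm h * norm z" for h z
    using order_trans[OF KB(2) mult_left_mono[OF KL(2), of KB]] KB(1)
    by (simp add: loop_add mult.assoc)
  define \<delta> where "\<delta> = \<eta> / (KB * KL)"
  have small: "KB * KL * norm h \<le> \<eta>" if "norm h < \<delta>" for h :: 'p
    using that KB KL by (simp add: \<delta>_def field_simps)
  have d0: "0 \<le> KB * KL * norm h" for h :: 'p using KB KL by simp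
  note pert' = pert[rule_format, OF linear_loop d0 small close]
  define CC where "CC = 2 * (C * (KE * KL) * (KB * KL)) + KH * KL\<^sup>2 * C"
  have "0 < CC" using \<eta> KE KL KB KH by (simp add: CC_def add_pos_pos)
  moreover have "\<bar>val (p + h) z z - val p z z - val_deriv p h z\<bar> \<le> CC * (norm h)\<^sup>2 * (norm z)\<^sup>2"
    if h: "norm h < \<delta>" for h z
  proof -
    define G where "G = loop (p + h)"
    have stG: "mean_square_stable \<gamma> G" using pert'[OF h] by (simp add: G_def)
    note smG = summable_discounted_form[OF stG _ \<gamma>_pos]
    have smn: "summable (\<lambda>t. \<gamma> ^ t * (norm ((G ^^ t) z))\<^sup>2)"
      using stG by (simp add: mean_square_stable_def)
    have bH: "bilinear (\<lambda>z w. input_hess p (L h z) (L h w))"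
      using bilinear_input_hess
      by (simp add: bilinear_def linear_iff bilinear_ladd[OF bilinear_input_hess] bilinear_radd[OF bilinear_input_hess]
          bilinear_lmul[OF bilinear_input_hess] bilinear_rmul[OF bilinear_input_hess] L_simps)
    have val_eq: "val (p + h) z z = val p z z + 2 * discounted_form \<gamma> G (dir_form p h) z z
        + discounted_form \<gamma> G (\<lambda>z w. input_hess p (L h z) (L h w)) z z"
    proof -
      have "(\<lambda>T. \<Sum>t<T. \<gamma> ^ t * cost (p + h) ((G ^^ t) z) ((G ^^ t) z)) \<longlonglongrightarrow> val (p + h) z z"
        unfolding val_def discounted_form_def G_def[symmetric]
        by (intro summable_LIMSEQ smG bilinear_cost)
      moreover have "(\<lambda>T. val p z z - \<gamma> ^ T * val p ((G ^^ T) z) ((G ^^ T) z)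
          + (2 * (\<Sum>t<T. \<gamma> ^ t * dir_form p h ((G ^^ t) z) ((G ^^ t) z))
            + (\<Sum>t<T. \<gamma> ^ t * input_hess p (L h ((G ^^ t) z)) (L h ((G ^^ t) z)))))
        \<longlonglongrightarrow> val p z z - 0 + (2 * discounted_form \<gamma> G (dir_form p h) z z
            + discounted_form \<gamma> G (\<lambda>z w. input_hess p (L h z) (L h w)) z z)"
        unfolding discounted_form_def
        by (intro tendsto_intros summable_LIMSEQ smG bilinear_dir_form bH
            summable_square_imp_discounted_null[OF bilinear_val \<gamma>_pos] smn)
      moreover have "(\<Sum>t<T. \<gamma> ^ t * cost (p + h) ((G ^^ t) z) ((G ^^ t) z))
        = val p z z - \<gamma> ^ T * val p ((G ^^ T) z) ((G ^^ T) z)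
          + (2 * (\<Sum>t<T. \<gamma> ^ t * dir_form p h ((G ^^ t) z) ((G ^^ t) z))
            + (\<Sum>t<T. \<gamma> ^ t * input_hess p (L h ((G ^^ t) z)) (L h ((G ^^ t) z))))" for T
        using performance_difference[of h z T]
        by (simp add: G_def dir_form_def distrib_left sum.distrib sum_distrib_left mult.left_commute)
      ultimately show ?thesis
        using LIMSEQ_unique by fastforce
    qed
    have dir_bd: "\<bar>dir_form p h z w\<bar> \<le> KE * (KL * norm h) * norm z * norm w" for z w
    proof -
      have "\<bar>dir_form p h z w\<bar> \<le> norm (input_grad p z) * norm (L h w)"
        unfolding dir_form_def by (rule Cauchy_Schwarz_ineq2)
      also have "\<dots> \<le> (KE * norm z) * (KL * norm h * norm w)"
        by (intro mult_mono KE KL) (use KE in auto)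
      finally show ?thesis by (simp add: mult_ac)
    qed
    have first: "\<bar>discounted_form \<gamma> G (dir_form p h) z z - discounted_form \<gamma> (loop p) (dir_form p h) z z\<bar>
        \<le> C * (KE * (KL * norm h)) * (KB * KL * norm h) * (norm z)\<^sup>2"
      using pert'[OF h] bilinear_dir_form dir_bd unfolding G_def by blast
    have second: "\<bar>discounted_form \<gamma> G (\<lambda>z w. input_hess p (L h z) (L h w)) z z\<bar>
        \<le> KH * (KL * norm h)\<^sup>2 * (C * (norm z)\<^sup>2)"
    proof -
      have "norm (\<gamma> ^ t * input_hess p (L h ((G ^^ t) z)) (L h ((G ^^ t) z)))
          \<le> KH * (KL * norm h)\<^sup>2 * (\<gamma> ^ t * (norm ((G ^^ t) z))\<^sup>2)" for t
      proof -
        let ?y = "(G ^^ t) z"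
        have "norm (input_hess p (L h ?y) (L h ?y)) \<le> KH * (norm (L h ?y))\<^sup>2"
          using KH(2)[of "L h ?y" "L h ?y"] by (simp add: power2_eq_square mult.assoc)
        also have "\<dots> \<le> KH * (KL * norm h * norm ?y)\<^sup>2"
          using KH(1) by (intro mult_left_mono power_mono KL) auto
        finally have "\<gamma> ^ t * norm (input_hess p (L h ?y) (L h ?y)) \<le> \<gamma> ^ t * (KH * (KL * norm h * norm ?y)\<^sup>2)"
          using \<gamma>_pos by (intro mult_left_mono) auto
        then show ?thesis using \<gamma>_pos by (simp add: abs_mult power_mult_distrib mult_ac)
      qed
      then have "\<bar>discounted_form \<gamma> G (\<lambda>z w. input_hess p (L h z) (L h w)) z z\<bar>
          \<le> (\<Sum>t. KH * (KL * norm h)\<^sup>2 * (\<gamma> ^ t * (norm ((G ^^ t) z))\<^sup>2))"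
        unfolding discounted_form_def real_norm_def[symmetric]
        by (intro norm_suminf_le summable_mult smn) auto
      also have "\<dots> = KH * (KL * norm h)\<^sup>2 * (\<Sum>t. \<gamma> ^ t * (norm ((G ^^ t) z))\<^sup>2)"
        by (intro suminf_mult smn)
      also have "\<dots> \<le> KH * (KL * norm h)\<^sup>2 * (C * (norm z)\<^sup>2)"
        using pert'[OF h] KH(1) unfolding G_def by (intro mult_left_mono) auto
      finally show ?thesis .
    qed
    have "\<bar>val (p + h) z z - val p z z - val_deriv p h z\<bar>
      \<le> 2 * (C * (KE * (KL * norm h)) * (KB * KL * norm h) * (norm z)\<^sup>2)
        + KH * (KL * norm h)\<^sup>2 * (C * (norm z)\<^sup>2)"
      using first second unfolding val_eq val_deriv_def by linarith
    then show ?thesis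
      by (simp add: CC_def power2_eq_square algebra_simps)
  qed
  moreover have "0 < \<delta>" using \<eta> KB KL by (simp add: \<delta>_def)
  ultimately show ?thesis using that[of \<delta> CC] pert' by blast
qed

lemma linear_val_deriv: "linear (\<lambda>h. val_deriv p h z)"
proof -
  note sm = summable_discounted_form[OF stable bilinear_dir_form \<gamma>_pos]
  have *: "\<gamma> ^ t * dir_form p (h + k) z w = \<gamma> ^ t * dir_form p h z w + \<gamma> ^ t * dir_form p k z w"
    "\<gamma> ^ t * dir_form p (c *\<^sub>R h) z w = c * (\<gamma> ^ t * dir_form p h z w)" for t h k z w c
    by (simp_all add: dir_form_def L_simps inner_add_right algebra_simps)
  show ?thesis
    by (rule linearI)
      (simp_all add: val_deriv_def discounted_form_def * suminf_add[OF sm sm, symmetric] suminf_mult[OF sm])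
qed

end

end

section \<open>Spectral radius and growth of orbits\<close>

text \<open>
  This is \<open>q(M) v\<close>, evaluated by the Horner scheme.
\<close>
definition poly_act :: "complex^'n^'n \<Rightarrow> complex poly \<Rightarrow> complex^'n \<Rightarrow> complex^'n" where
  "poly_act M q v = fold_coeffs (\<lambda>a w. a *s v + M *v w) q 0"

lemma poly_act_0 [simp]: "poly_act M 0 v = 0"
  by (simp add: poly_act_def)

lemma poly_act_pCons [simp]: "poly_act M (pCons a q) v = a *s v + M *v poly_act M q v"
  by (cases "a = 0 \<and> q = 0") (auto simp: poly_act_def)

lemma poly_act_add: "poly_act M (p + q) v = poly_act M p v + poly_act M q v"
  by (induction p q rule: poly_induct2)
    (simp_all add: vector_sadd_rdistrib matrix_vector_right_distrib algebra_simps)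

lemma poly_act_smult: "poly_act M (smult c q) v = c *s poly_act M q v"
  by (induction q) (simp_all add: vector_add_ldistrib vector_smult_assoc vector_scalar_commute)

lemma poly_act_sum: "poly_act M (sum f I) v = (\<Sum>i\<in>I. poly_act M (f i) v)"
  by (induction I rule: infinite_finite_induct) (simp_all add: poly_act_add)

lemma poly_act_monom: "poly_act M (monom c i) v = c *s (((*v) M) ^^ i) v"
  by (induction i) (simp_all add: monom_0 monom_Suc vector_scalar_commute)

lemma poly_act_linear_factor:
  "poly_act M ([:- z, 1:] * q) v = M *v poly_act M q v - z *s poly_act M q v"
proof -
  have "[:- z, 1:] * q = pCons 0 q + smult (- z) q" by simp
  then show ?thesis by (simp only: poly_act_add poly_act_smult poly_act_pCons) (simp add: vector_smult_lneg)
qed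

lemma poly_act_commute: "poly_act M q (M *v v - z *s v) = M *v poly_act M q v - z *s poly_act M q v"
proof (induction q)
  case (pCons a q)
  have "a *s (M *v v - z *s v) + M *v (M *v poly_act M q v - z *s poly_act M q v)
      = M *v (a *s v + M *v poly_act M q v) - z *s (a *s v + M *v poly_act M q v)"
    by (simp add: matrix_vector_right_distrib matrix_vector_mult_diff_distrib vector_scalar_commute
        vector_add_ldistrib vector_ssub_ldistrib vector_smult_assoc mult.commute)
  then show ?case by (simp add: pCons.IH)
qed simp

lemma poly_act_eigenvector:
  assumes "M *v v = z *s v"
  shows "poly_act M q v = poly q z *s v"
  by (induction q) (simp_all add: assms vector_scalar_commute vector_smult_assoc vector_sadd_rdistrib mult.commute)

lemma norm_vector_smult: "norm (z *s v) = cmod z * norm v" for v :: "complex^'n"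
  by (simp add: norm_vec_def L2_set_right_distrib norm_mult)

text \<open>
  By induction on the degree. Over the complex numbers \<open>q\<close> has a linear
  factor \<open>x - z\<close>. If \<open>z\<close> is not an eigenvalue, then \<open>M - z\<close> is injective and the factor can be
  cancelled. Otherwise the induction hypothesis bounds the orbit of \<open>w = M v - z v\<close>, and
  \<open>M\<^sup>t\<^sup>+\<^sup>1 v = M\<^sup>t w + z M\<^sup>t v\<close> with \<open>|z| < r\<close> carries the bound over to \<open>v\<close>.
\<close>
lemma orbit_bounded_if_annihilated:
  fixes M :: "complex^'n^'n"
  assumes r: "0 < r" and ev: "\<And>z v. v \<noteq> 0 \<Longrightarrow> M *v v = z *s v \<Longrightarrow> cmod z < r"
    and "q \<noteq> 0" "poly_act M q v = 0"
  shows "\<exists>C\<ge>0. \<forall>t. norm ((((*v) M) ^^ t) v) \<le> C * r ^ t"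
  using assms(3,4)
proof (induction "degree q" arbitrary: q v)
  case 0
  then obtain a where "q = [:a:]" "a \<noteq> 0" by (metis degree_eq_zeroE pCons_0_0)
  then have "v = 0" using 0 by (simp add: vector_mul_eq_0)
  moreover have "(((*v) M) ^^ t) 0 = 0" for t by (induction t) auto
  ultimately show ?case by (intro exI[of _ 0]) simp
next
  case (Suc n)
  then have "\<not> constant (poly q)" by (simp add: constant_degree)
  then obtain z where "poly q z = 0" using fundamental_theorem_of_algebra by blast
  then obtain q' where q': "q = [:- z, 1:] * q'" by (metis poly_eq_0_iff_dvd dvdE)
  then have "q' \<noteq> 0" using Suc.prems by auto
  then have "degree q = Suc (degree q')" by (simp add: q' degree_mult_eq del: mult_pCons_left)
  then have deg: "n = degree q'" using Suc.hyps(2) by simp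
  show ?case
  proof (cases "\<exists>u. u \<noteq> 0 \<and> M *v u = z *s u")
    case False
    have "M *v poly_act M q' v = z *s poly_act M q' v"
      using Suc.prems(2) by (simp add: q' poly_act_linear_factor del: mult_pCons_left)
    with False have "poly_act M q' v = 0" by blast
    then show ?thesis using Suc.hyps(1)[OF deg \<open>q' \<noteq> 0\<close>] by blast
  next
    case True
    then have z: "cmod z < r" using ev by blast
    define w where "w = M *v v - z *s v"
    have "poly_act M q' w = 0"
      using Suc.prems(2) by (simp add: q' poly_act_linear_factor poly_act_commute w_def del: mult_pCons_left)
    then obtain C where C: "0 \<le> C" "\<And>t. norm ((((*v) M) ^^ t) w) \<le> C * r ^ t"
      using Suc.hyps(1)[OF deg \<open>q' \<noteq> 0\<close>] by blast
    have step: "(((*v) M) ^^ Suc t) v = (((*v) M) ^^ t) w + z *s (((*v) M) ^^ t) v" for t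
      by (induction t)
        (simp_all add: w_def matrix_vector_right_distrib vector_scalar_commute)
    \<comment> \<open>The least constant that dominates \<open>norm v\<close> and is preserved by the recursion \<open>C + |z| D \<le> D r\<close>.\<close>
    define D where "D = max (norm v) (C / (r - cmod z))"
    have D: "norm v \<le> D" "C \<le> D * (r - cmod z)"
      using z by (auto simp: D_def field_simps max_def)
    have "norm ((((*v) M) ^^ t) v) \<le> D * r ^ t" for t
    proof (induction t)
      case (Suc t)
      have "norm ((((*v) M) ^^ Suc t) v) \<le> C * r ^ t + cmod z * (D * r ^ t)"
        unfolding step
        by (intro order_trans[OF norm_triangle_ineq] add_mono C)
          (auto simp: norm_vector_smult intro!: mult_left_mono Suc)
      also have "\<dots> \<le> D * (r - cmod z) * r ^ t + cmod z * (D * r ^ t)"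
        using mult_right_mono[OF D(2), of "r ^ t"] r by simp
      finally show ?case by (simp add: algebra_simps)
    qed (use D in simp)
    moreover have "0 \<le> D" using D(1) norm_ge_zero order_trans by blast
    ultimately show ?thesis by blast
  qed
qed

lemma map_matrix_of_real_mult_vec:
  fixes M :: "real^'n^'m" and x :: "real^'n"
  shows "map_matrix complex_of_real M *v (\<chi> i. complex_of_real (x $ i)) = (\<chi> i. complex_of_real ((M *v x) $ i))"
  by (simp add: vec_eq_iff matrix_vector_mult_def map_matrix_def)

lemma map_matrix_of_real_mult:
  fixes M :: "real^'n^'m" and N :: "real^'k^'n"
  shows "map_matrix complex_of_real (M ** N) = map_matrix complex_of_real M ** map_matrix complex_of_real N"
  by (simp add: vec_eq_iff matrix_matrix_mult_def map_matrix_def)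

lemma complex_funpow_eq_mat_pow:
  fixes M :: "real^'n^'n"
  shows "(((*v) (map_matrix complex_of_real M)) ^^ t) v = map_matrix complex_of_real (mat_pow M t) *v v"
proof (induction t)
  case 0
  have "map_matrix complex_of_real (mat 1 :: real^'n^'n) = mat 1"
    by (simp add: vec_eq_iff mat_def map_matrix_def)
  then show ?case by simp
qed (simp add: map_matrix_of_real_mult matrix_vector_mul_assoc)

text \<open>
  A relation between the members of the family, not the elements of its range: a repeated member
  already gives one.
\<close>
lemma exists_linear_relation:
  fixes f :: "nat \<Rightarrow> 'a::euclidean_space"
  shows "\<exists>a N. (\<exists>i\<le>N. a i \<noteq> 0) \<and> (\<Sum>i\<le>N. a i *\<^sub>R f i) = 0"
proof (cases "inj_on f {..DIM('a)}")
  case True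
  let ?S = "f ` {..DIM('a)}"
  have "dependent ?S"
    using independent_bound[of ?S] True by (auto simp: card_image)
  then obtain u where u: "\<exists>v\<in>?S. u v \<noteq> 0" "(\<Sum>v\<in>?S. u v *\<^sub>R v) = 0"
    by (auto simp: dependent_finite)
  then show ?thesis
    using True by (intro exI[of _ "u \<circ> f"] exI[of _ "DIM('a)"]) (auto simp: sum.reindex)
next
  case False
  then obtain i j where ij: "i \<noteq> j" "f i = f j" by (auto simp: inj_on_def)
  let ?a = "\<lambda>k. if k = i then 1 else if k = j then -1 else (0::real)"
  have "(\<Sum>k\<le>max i j. ?a k *\<^sub>R f k) = (\<Sum>k\<le>max i j. (if k = i then f i else 0) + (if k = j then - f j else 0))"
    using ij by (intro sum.cong) auto
  also have "\<dots> = 0" using ij by (simp add: sum.distrib)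
  finally show ?thesis by (intro exI[of _ ?a] exI[of _ "max i j"]) (auto intro!: exI[of _ i])
qed

text \<open>
  The powers of \<open>M\<close> are linearly dependent in the finite-dimensional space of matrices.
\<close>
lemma exists_annihilating_poly:
  fixes M :: "real^'n^'n"
  shows "\<exists>q. q \<noteq> 0 \<and> (\<forall>v. poly_act (map_matrix complex_of_real M) q v = 0)"
proof -
  obtain a N where a: "\<exists>i\<le>N. a i \<noteq> 0" "(\<Sum>i\<le>N. a i *\<^sub>R mat_pow M i) = 0"
    using exists_linear_relation[of "mat_pow M"] by blast
  let ?q = "\<Sum>i\<le>N. monom (complex_of_real (a i)) i"
  have "coeff ?q i = a i" if "i \<le> N" for i
    using that by (simp add: coeff_sum)
  then have "?q \<noteq> 0" using a(1) by (metis coeff_0 of_real_eq_0_iff)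
  moreover have "poly_act (map_matrix complex_of_real M) ?q v = 0" for v
  proof (subst vec_eq_iff, intro allI)
    fix j
    have entry: "(\<Sum>i\<le>N. a i * mat_pow M i $ j $ k) = 0" for k
      using arg_cong[OF a(2), of "\<lambda>X. X $ j $ k"] by simp
    have "poly_act (map_matrix complex_of_real M) ?q v $ j
        = (\<Sum>i\<le>N. \<Sum>k\<in>UNIV. complex_of_real (a i * mat_pow M i $ j $ k) * v $ k)"
      unfolding poly_act_sum poly_act_monom complex_funpow_eq_mat_pow
      by (simp add: matrix_vector_mult_def map_matrix_def sum_distrib_left mult.assoc)
    also have "\<dots> = (\<Sum>k\<in>UNIV. \<Sum>i\<le>N. complex_of_real (a i * mat_pow M i $ j $ k) * v $ k)"
      by (rule sum.swap)
    also have "\<dots> = (\<Sum>k\<in>UNIV. complex_of_real (\<Sum>i\<le>N. a i * mat_pow M i $ j $ k) * v $ k)"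
      by (simp only: of_real_sum sum_distrib_right)
    finally show "poly_act (map_matrix complex_of_real M) ?q v $ j = 0 $ j" by (simp add: entry)
  qed
  ultimately show ?thesis by blast
qed

text \<open>
  The maximum in the definition of the spectral radius is meaningful because the eigenvalues are
  roots of an annihilating polynomial and so finite in number.
\<close>
lemma cmod_le_spec_radius:
  assumes "z \<in> complex_eigenvalues M"
  shows "cmod z \<le> spec_radius M"
proof -
  obtain q where q: "q \<noteq> 0" "\<And>v. poly_act (map_matrix complex_of_real M) q v = 0"
    using exists_annihilating_poly[of M] by blast
  have "complex_eigenvalues M \<subseteq> {z. poly q z = 0}"
  proof (clarsimp simp: complex_eigenvalues_def)
    fix z v assume v: "v \<noteq> 0" "map_matrix complex_of_real M *v v = z *s v"
    show "poly q z = 0"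
      using poly_act_eigenvector[OF v(2), of q] q(2)[of v] v(1) by (simp add: vector_mul_eq_0)
  qed
  then have "finite (complex_eigenvalues M)"
    using poly_roots_finite[OF q(1)] finite_subset by blast
  then show ?thesis using assms by (simp add: spec_radius_def)
qed

lemma orbit_bounded_if_spec_radius_less:
  fixes M :: "real^'n^'n"
  assumes "spec_radius M < r" "0 < r"
  shows "\<exists>C\<ge>0. \<forall>t. norm ((((*v) M) ^^ t) x) \<le> C * r ^ t"
proof -
  let ?M = "map_matrix complex_of_real M"
  let ?c = "\<lambda>x::real^'n. \<chi> i. complex_of_real (x $ i)"
  obtain q where q: "q \<noteq> 0" "\<And>v. poly_act ?M q v = 0"
    using exists_annihilating_poly[of M] by blast
  have "cmod z < r" if "v \<noteq> 0" "?M *v v = z *s v" for z v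
    using cmod_le_spec_radius[of z M] that assms by (fastforce simp: complex_eigenvalues_def)
  then obtain C where C: "0 \<le> C" "\<And>t. norm ((((*v) ?M) ^^ t) (?c x)) \<le> C * r ^ t"
    using orbit_bounded_if_annihilated[OF \<open>0 < r\<close> _ q] by blast
  have "(((*v) ?M) ^^ t) (?c x) = ?c ((((*v) M) ^^ t) x)" for t
    by (induction t) (simp_all add: map_matrix_of_real_mult_vec)
  moreover have "norm (?c y) = norm y" for y
    by (simp add: norm_vec_def)
  ultimately show ?thesis using C by metis
qed

section \<open>Moments of the normal distribution\<close>

text \<open>
  The minimum over the unit sphere is attained and positive.
\<close>
lemma pos_bilinear_coercive:
  fixes s :: "'a::euclidean_space \<Rightarrow> 'a \<Rightarrow> real"
  assumes s: "bilinear s" and pos: "\<And>x. x \<noteq> 0 \<Longrightarrow> 0 < s x x"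
  obtains c where "0 < c" "\<And>x. c * (norm x)\<^sup>2 \<le> s x x"
proof -
  have "compact (sphere (0::'a) 1)" by simp
  moreover have "sphere (0::'a) 1 \<noteq> {}" by simp
  moreover have "continuous_on (sphere (0::'a) 1) (\<lambda>x. s x x)"
    using bilinear_continuous_on_compose[OF continuous_on_id continuous_on_id, of s] s
    by (simp add: bilinear_conv_bounded_bilinear)
  ultimately obtain u where u: "norm u = 1" "\<And>x. norm x = 1 \<Longrightarrow> s u u \<le> s x x"
    using continuous_attains_inf[of "sphere (0::'a) 1" "\<lambda>x. s x x"] by auto
  have "s u u * (norm x)\<^sup>2 \<le> s x x" for x
  proof (cases "x = 0")
    case False
    have "s u u \<le> s (x /\<^sub>R norm x) (x /\<^sub>R norm x)" using False by (intro u) simp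
    also have "\<dots> = s x x / (norm x)\<^sup>2"
      by (simp add: bilinear_lmul[OF s] bilinear_rmul[OF s] field_simps power2_eq_square)
    finally show ?thesis using False by (simp add: field_simps)
  qed (simp add: bilinear_lzero[OF s])
  moreover have "0 < s u u" using u(1) by (intro pos) auto
  ultimately show ?thesis using that by blast
qed

lemma bilinear_matrix_form: "bilinear (\<lambda>x y. x \<bullet> (M *v y))" for M :: "real^'n^'n"
  by (simp add: bilinear_def linear_iff inner_add_left inner_add_right matrix_vector_right_distrib
      matrix_vector_mult_scaleR)

lemma sym_pos_def_coercive:
  fixes M :: "real^'n^'n"
  assumes "sym_pos_def M"
  obtains c where "0 < c" "\<And>x. c * (norm x)\<^sup>2 \<le> x \<bullet> (M *v x)"
  using pos_bilinear_coercive[OF bilinear_matrix_form[of M]] assms unfolding sym_pos_def_def by metis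

lemma pos_def_det_nonzero:
  fixes M :: "real^'n^'n"
  assumes "\<And>x. x \<noteq> 0 \<Longrightarrow> 0 < x \<bullet> (M *v x)"
  shows "det M \<noteq> 0"
proof -
  have "\<forall>x. M *v x = 0 \<longrightarrow> x = 0" using assms by (metis inner_zero_right less_irrefl)
  then show ?thesis
    using matrix_left_invertible_ker[of M] invertible_left_inverse[of M] invertible_det_nz[of M] by blast
qed

text \<open>
  The determinant does not vanish on the segment from the identity to \<open>M\<close>, so it keeps its sign.
\<close>
lemma sym_pos_def_det_pos:
  fixes M :: "real^'n^'n"
  assumes "sym_pos_def M"
  shows "0 < det M"
proof (rule ccontr)
  define N where "N t = (1 - t) *\<^sub>R mat 1 + t *\<^sub>R M" for t
  have "det (N t) \<noteq> 0" if "0 \<le> t" "t \<le> 1" for t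
  proof (rule pos_def_det_nonzero)
    fix x :: "real^'n" assume "x \<noteq> 0"
    then have "0 < x \<bullet> x" "0 < x \<bullet> (M *v x)" using assms by (auto simp: sym_pos_def_def)
    moreover have "x \<bullet> (N t *v x) = (1 - t) * (x \<bullet> x) + t * (x \<bullet> (M *v x))"
      by (simp add: N_def matrix_vector_mult_add_rdistrib scaleR_matrix_vector_assoc[symmetric] inner_add_right)
    ultimately show "0 < x \<bullet> (N t *v x)"
      using that by (cases "t = 1") (auto intro!: add_pos_nonneg)
  qed
  moreover have "continuous_on {0..1} (\<lambda>t. det (N t))"
    unfolding det_def N_def by (intro continuous_intros)
  moreover assume "\<not> 0 < det M"
  then have "det (N 1) \<le> 0" "0 \<le> det (N 0)" by (simp_all add: N_def)
  ultimately show False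
    using IVT2'[of "\<lambda>t. det (N t)" 1 0 0] by auto
qed

lemma sym_pos_def_inverse_coercive:
  fixes M :: "real^'n^'n"
  assumes "sym_pos_def M"
  obtains c where "0 < c" "\<And>x. c * (norm x)\<^sup>2 \<le> x \<bullet> (matrix_inv M *v x)"
proof -
  have "invertible M" using sym_pos_def_det_pos[OF assms] by (simp add: invertible_det_nz)
  then have inv: "M ** matrix_inv M = mat 1"
    unfolding invertible_def matrix_inv_def by (rule someI2_ex) simp
  have "0 < x \<bullet> (matrix_inv M *v x)" if "x \<noteq> 0" for x
  proof -
    define y where "y = matrix_inv M *v x"
    have x: "x = M *v y" by (simp add: y_def matrix_vector_mul_assoc inv)
    with that have "y \<noteq> 0" by auto
    then show ?thesis using assms unfolding y_def[symmetric] by (simp add: x inner_commute sym_pos_def_def)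
  qed
  then show ?thesis using pos_bilinear_coercive[OF bilinear_matrix_form[of "matrix_inv M"]] that by blast
qed

lemma integrable_gaussian:
  assumes "0 < k"
  shows "integrable lborel (\<lambda>x::'a::euclidean_space. exp (- k * (norm x)\<^sup>2))"
proof (rule integrableI_bounded)
  \<comment> \<open>The standard deviation for which the normal density is a multiple of \<open>exp (- k * t\<^sup>2)\<close>.\<close>
  define \<sigma> where "\<sigma> = 1 / sqrt (2 * k)"
  have \<sigma>: "0 < \<sigma>" "2 * \<sigma>\<^sup>2 = 1 / k" using assms by (auto simp: \<sigma>_def power_divide)
  have "exp (- k * t\<^sup>2) = sqrt (2 * pi * \<sigma>\<^sup>2) * normal_density 0 \<sigma> t" for t
    using \<sigma> by (simp add: normal_density_def)
  then have "integrable lborel (\<lambda>t. exp (- k * t\<^sup>2))" using \<sigma>(1) by simp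
  then have fin: "(\<integral>\<^sup>+t. ennreal (exp (- k * t\<^sup>2)) \<partial>lborel) < \<infinity>"
    by (simp add: integrable_iff_bounded)
  have "(norm x)\<^sup>2 = (\<Sum>b\<in>Basis. (x \<bullet> b)\<^sup>2)" for x :: 'a
    unfolding power2_norm_eq_inner by (subst euclidean_inner) (simp add: power2_eq_square)
  then have "exp (- k * (norm x)\<^sup>2) = (\<Prod>b\<in>Basis. exp (- k * (x \<bullet> b)\<^sup>2))" for x :: 'a
    by (simp add: exp_sum[symmetric] sum_distrib_left sum_negf)
  then have "(\<integral>\<^sup>+x. ennreal (norm (exp (- k * (norm (x::'a))\<^sup>2))) \<partial>lborel)
      = (\<integral>\<^sup>+x. (\<Prod>b\<in>Basis. ennreal (exp (- k * ((x::'a) \<bullet> b)\<^sup>2))) \<partial>lborel)"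
    by (simp add: prod_ennreal abs_prod)
  also have "\<dots> = (\<Prod>b\<in>(Basis::'a set). \<integral>\<^sup>+t. ennreal (exp (- k * t\<^sup>2)) \<partial>lborel)"
    by (intro nn_integral_lborel_prod) auto
  also have "\<dots> < \<infinity>" using fin by (simp add: power_less_top_ennreal)
  finally show "(\<integral>\<^sup>+x. ennreal (norm (exp (- k * (norm (x::'a))\<^sup>2))) \<partial>lborel) < \<infinity>" .
qed simp

definition normal_pdf :: "real^'n^'n \<Rightarrow> real^'n \<Rightarrow> real" where
  "normal_pdf S x = exp (- (x \<bullet> (matrix_inv S *v x)) / 2) / sqrt ((2 * pi) ^ CARD('n) * det S)"

lemma normal_vec_eq: "normal_vec 0 S = density lborel (\<lambda>x. ennreal (normal_pdf S x))"
  by (simp add: normal_vec_def normal_pdf_def)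

lemma sets_normal_vec [measurable_cong, simp]: "sets (normal_vec m S) = sets borel"
  by (simp add: normal_vec_def)

lemma space_normal_vec [simp]: "space (normal_vec m S) = UNIV"
  by (simp add: normal_vec_def)

lemma borel_measurable_normal_pdf [measurable]: "normal_pdf S \<in> borel_measurable borel"
  unfolding normal_pdf_def
  by (intro borel_measurable_divide borel_measurable_const)
    (intro borel_measurable_continuous_onI continuous_intros, simp)

lemma normal_pdf_pos: "sym_pos_def S \<Longrightarrow> 0 < normal_pdf S x"
  using sym_pos_def_det_pos[of S] by (simp add: normal_pdf_def)

text \<open>
  Half of the Gaussian decay absorbs the quadratic factor.
\<close>
lemma integrable_normal_vec_second_moment:
  fixes S :: "real^'n^'n"
  assumes "sym_pos_def S"
  shows "integrable (normal_vec 0 S) (\<lambda>x. 1 + (norm x)\<^sup>2)"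
proof -
  obtain c where c: "0 < c" "\<And>x. c * (norm x)\<^sup>2 \<le> x \<bullet> (matrix_inv S *v x)"
    using sym_pos_def_inverse_coercive[OF assms] by metis
  define d where "d = sqrt ((2 * pi) ^ CARD('n) * det S)"
  have d: "0 < d" using sym_pos_def_det_pos[OF assms] by (simp add: d_def)
  have "norm (normal_pdf S x * (1 + (norm x)\<^sup>2)) \<le> norm ((1 + 4 / c) / d * exp (- (c / 4) * (norm x)\<^sup>2))" for x
  proof -
    let ?e = "exp (c / 4 * (norm x)\<^sup>2)"
    have "1 \<le> ?e" "c / 4 * (norm x)\<^sup>2 \<le> ?e"
      using c(1) exp_ge_add_one_self[of "c / 4 * (norm x)\<^sup>2"] by (auto simp del: exp_ge_add_one_self)
    then have "1 + (norm x)\<^sup>2 \<le> ?e + 4 / c * ?e"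
      using c(1) by (intro add_mono) (simp_all add: field_simps)
    then have "1 + (norm x)\<^sup>2 \<le> (1 + 4 / c) * ?e" by (simp add: distrib_right)
    moreover have "normal_pdf S x \<le> exp (- (c / 2) * (norm x)\<^sup>2) / d"
      unfolding normal_pdf_def d_def[symmetric]
      using d c(2)[of x] by (intro divide_right_mono) auto
    ultimately have "normal_pdf S x * (1 + (norm x)\<^sup>2)
        \<le> exp (- (c / 2) * (norm x)\<^sup>2) / d * ((1 + 4 / c) * ?e)"
      using d by (intro mult_mono) auto
    also have "\<dots> = (1 + 4 / c) / d * (exp (- (c / 2) * (norm x)\<^sup>2) * ?e)" by simp
    also have "exp (- (c / 2) * (norm x)\<^sup>2) * ?e = exp (- (c / 4) * (norm x)\<^sup>2)"
      by (simp add: exp_add[symmetric] algebra_simps)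
    finally show ?thesis
      using d c(1) less_imp_le[OF normal_pdf_pos[OF assms, of x]] by (simp add: abs_mult)
  qed
  moreover have "integrable lborel (\<lambda>x::real^'n. (1 + 4 / c) / d * exp (- (c / 4) * (norm x)\<^sup>2))"
    using integrable_gaussian[of "c / 4"] c(1) by (intro integrable_mult_right) auto
  ultimately have "integrable lborel (\<lambda>x. normal_pdf S x * (1 + (norm x)\<^sup>2))"
    by (intro Bochner_Integration.integrable_bound[where g = "\<lambda>x. normal_pdf S x * (1 + (norm x)\<^sup>2)"]) auto
  then show ?thesis
    unfolding normal_vec_eq
    by (subst integrable_density) (auto simp: less_imp_le[OF normal_pdf_pos[OF assms]])
qed

lemma integrable_normal_vec_quadratic:
  assumes S: "sym_pos_def S" and f: "f \<in> borel_measurable borel"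
    and bd: "\<And>x. \<bar>f x\<bar> \<le> C * (1 + (norm x)\<^sup>2)"
  shows "integrable (normal_vec 0 S) (f :: real^'n \<Rightarrow> real)"
proof (rule Bochner_Integration.integrable_bound)
  show "integrable (normal_vec 0 S) (\<lambda>x. C * (1 + (norm x)\<^sup>2))"
    by (intro integrable_mult_right integrable_normal_vec_second_moment S)
  show "f \<in> borel_measurable (normal_vec 0 S)" using f by (simp cong: measurable_cong_sets)
  show "AE x in normal_vec 0 S. norm (f x) \<le> norm (C * (1 + (norm x)\<^sup>2))"
    using order_trans[OF bd abs_ge_self] by simp
qed

text \<open>
  The second moment matrix of \<open>(x, 1)\<close> is positive definite: an affine function that vanishes
  almost everywhere for a positive density is zero, since hyperplanes are null sets.
\<close>
lemma normal_vec_affine_coercive: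
  fixes S :: "real^'n^'n"
  assumes S: "sym_pos_def S"
  obtains c where "0 < c"
    "\<And>a b. c * ((norm a)\<^sup>2 + b\<^sup>2) \<le> (\<integral>x. (a \<bullet> x + b)\<^sup>2 \<partial>normal_vec 0 S)"
proof -
  let ?N = "normal_vec 0 S"
  define f where "f w x = fst w \<bullet> x + snd w" for w :: "(real^'n) \<times> real" and x
  define m where "m v w = (\<integral>x. f v x * f w x \<partial>?N)" for v w
  have f_bd: "\<bar>f w x\<bar> \<le> norm w * (1 + norm x)" for w x
  proof -
    have "\<bar>f w x\<bar> \<le> norm (fst w) * norm x + \<bar>snd w\<bar>"
      unfolding f_def using Cauchy_Schwarz_ineq2[of "fst w" x] by linarith
    also have "\<dots> \<le> norm w * norm x + norm w"
      using norm_fst_le[of "fst w" "snd w"] norm_snd_le[of "snd w" "fst w"]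
      by (intro add_mono mult_right_mono) auto
    finally show ?thesis by (simp add: algebra_simps)
  qed
  have int: "integrable ?N (\<lambda>x. f v x * f w x)" for v w
  proof (rule integrable_normal_vec_quadratic[OF S])
    show "(\<lambda>x. f v x * f w x) \<in> borel_measurable borel" unfolding f_def by measurable
    fix x
    have "\<bar>f v x * f w x\<bar> \<le> (norm v * (1 + norm x)) * (norm w * (1 + norm x))"
      unfolding abs_mult by (intro mult_mono f_bd) auto
    also have "\<dots> = norm v * norm w * (1 + norm x)\<^sup>2" by (simp add: power2_eq_square)
    also have "\<dots> \<le> norm v * norm w * (2 * (1 + (norm x)\<^sup>2))"
      using sum_squares_bound[of 1 "norm x"]
      by (intro mult_left_mono) (auto simp: power2_sum)
    finally show "\<bar>f v x * f w x\<bar> \<le> norm v * norm w * 2 * (1 + (norm x)\<^sup>2)" by (simp only: mult.assoc)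
  qed
  have m: "bilinear m"
  proof -
    have *: "f (v + w) x = f v x + f w x" "f (c *\<^sub>R v) x = c * f v x" for v w c x
      by (simp_all add: f_def inner_add_left algebra_simps)
    have "m (v + w) u = m v u + m w u" "m u (v + w) = m u v + m u w"
      "m (c *\<^sub>R v) u = c * m v u" "m u (c *\<^sub>R v) = c * m u v" for u v w c
      by (simp_all add: m_def * distrib_left distrib_right Bochner_Integration.integral_add[OF int int]
          mult.assoc mult.left_commute[of _ c])
    then show ?thesis by (simp add: bilinear_def linear_iff)
  qed
  have pos: "0 < m w w" if "w \<noteq> 0" for w
  proof (rule ccontr)
    assume "\<not> 0 < m w w"
    moreover have "0 \<le> m w w" unfolding m_def by (intro integral_nonneg_AE) auto
    ultimately have "m w w = 0" by simp
    then have "AE x in ?N. f w x * f w x = 0"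
      unfolding m_def by (subst (asm) integral_nonneg_eq_0_iff_AE[OF int]) auto
    then have "AE x in lborel. f w x = 0"
      unfolding normal_vec_eq
      by (subst (asm) AE_density) (auto simp: normal_pdf_pos[OF S])
    moreover have "AE x in lborel. f w x \<noteq> 0"
    proof -
      have set_eq: "{x. fst w \<bullet> x = - snd w} = {x. f w x = 0}" by (auto simp: f_def)
      have "negligible {x. f w x = 0}"
        using negligible_hyperplane[of "fst w" "- snd w"] that set_eq by (auto simp: prod_eq_iff)
      moreover have "{x. f w x = 0} \<in> sets lborel" unfolding f_def by measurable
      ultimately have "{x. f w x = 0} \<in> null_sets lborel"
        by (simp add: negligible_iff_null_sets null_sets_completion_iff)
      then show ?thesis by (rule AE_I'[where N = "{x. f w x = 0}"]) auto
    qed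
    ultimately have "AE x in (lborel :: (real^'n) measure). False" by eventually_elim simp
    then have "emeasure (lborel :: (real^'n) measure) UNIV = 0"
      using AE_iff_measurable[of UNIV "lborel :: (real^'n) measure" "\<lambda>_. False"] by simp
    then show False by simp
  qed
  obtain c where c: "0 < c" "\<And>w. c * (norm w)\<^sup>2 \<le> m w w"
    using pos_bilinear_coercive[OF m pos] by metis
  have "c * ((norm a)\<^sup>2 + b\<^sup>2) \<le> (\<integral>x. (a \<bullet> x + b)\<^sup>2 \<partial>?N)" for a b
    using c(2)[of "(a, b)"] by (simp add: m_def f_def norm_Pair power2_eq_square)
  with c(1) that show ?thesis by blast
qed

section \<open>The tracking problem\<close>

lemma norm_matrix_power2: "(norm M)\<^sup>2 = (\<Sum>i\<in>UNIV. (norm (M $ i))\<^sup>2)" for M :: "real^'n^'m"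
  by (simp add: norm_vec_def L2_set_def sum_nonneg)

lemma norm_matrix_vector_affine:
  "(norm (M *v x + e))\<^sup>2 = (\<Sum>i\<in>UNIV. (M $ i \<bullet> x + e $ i)\<^sup>2)" for M :: "real^'n^'m"
  by (simp add: norm_vec_def L2_set_def sum_nonneg matrix_vector_mul_component)

lemma norm_matrix_vector_le: "norm (M *v x) \<le> norm M * norm x" for M :: "real^'n^'m"
proof -
  have "(norm (M *v x))\<^sup>2 = (\<Sum>i\<in>UNIV. (M $ i \<bullet> x)\<^sup>2)"
    using norm_matrix_vector_affine[of M x 0] by simp
  also have "\<dots> \<le> (\<Sum>i\<in>UNIV. (norm (M $ i) * norm x)\<^sup>2)"
    by (intro sum_mono abs_le_square_iff[THEN iffD1]) (simp add: Cauchy_Schwarz_ineq2)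
  also have "\<dots> = (norm M * norm x)\<^sup>2"
    by (simp add: norm_matrix_power2 power_mult_distrib sum_distrib_right)
  finally show ?thesis by (rule power2_le_imp_le) simp
qed

lemma has_derivative_if_quadratic_remainder:
  fixes f :: "'a::euclidean_space \<Rightarrow> real"
  assumes D: "linear D" and "0 < \<eta>"
    and rem: "\<And>h. norm h < \<eta> \<Longrightarrow> \<bar>f (p + h) - f p - D h\<bar> \<le> C * (norm h)\<^sup>2"
  shows "(f has_derivative D) (at p)"
  unfolding has_derivative_at
proof
  show "bounded_linear D" using D by (simp add: linear_conv_bounded_linear)
  show "(\<lambda>h. norm (f (p + h) - f p - D h) / norm h) \<midarrow>0\<rightarrow> 0"
  proof (rule Lim_null_comparison[where g = "\<lambda>h. C * norm h"])
    show "(\<lambda>h::'a. C * norm h) \<midarrow>0\<rightarrow> 0"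
      using tendsto_mult_left[OF tendsto_norm[OF tendsto_ident_at], of C "0::'a" UNIV] by simp
    show "\<forall>\<^sub>F h in at 0. norm (norm (f (p + h) - f p - D h) / norm h) \<le> C * norm h"
      unfolding eventually_at
    proof (intro exI[of _ \<eta>] conjI ballI impI \<open>0 < \<eta>\<close>)
      fix h :: 'a assume "h \<noteq> 0 \<and> dist h 0 < \<eta>"
      then show "norm (norm (f (p + h) - f p - D h) / norm h) \<le> C * norm h"
        using rem[of h] by (simp add: field_simps power2_eq_square)
    qed
  qed
qed

text \<open>
  The constants \<open>r\<close> and \<open>l\<close> are lower bounds for the spectra of \<open>R\<close> and \<open>Q\<close>.
\<close>
locale lqr_tracking =
  fixes A Q S :: "real^'n^'n" and B :: "real^'k^'n" and R :: "real^'k^'k"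
    and \<gamma> r l :: real and xs :: "real^'n"
  assumes Q: "sym_pos_def Q" and R: "sym_pos_def R" and S: "sym_pos_def S"
    and \<gamma>: "0 < \<gamma>" "\<gamma> < 1"
    and r: "0 < r" "r * (norm u)\<^sup>2 \<le> u \<bullet> (R *v u)"
    and l: "0 < l" "l * (norm x)\<^sup>2 \<le> x \<bullet> (Q *v x)"
begin

lemma sym_form: "sym_pos_def M \<Longrightarrow> x \<bullet> (M *v y) = y \<bullet> (M *v x)" for M :: "real^'m^'m"
  by (metis sym_pos_def_def dot_lmul_matrix inner_commute transpose_matrix_vector)

text \<open>
  The target is appended to the state. The pair \<open>z = (x, xs)\<close> evolves linearly with constant second
  component, the input \<open>K x + Kt xs\<close> is linear in \<open>z\<close>, and the tracking cost is a quadratic form in \<open>z\<close>.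
\<close>
sublocale linear_quadratic
  "\<lambda>z. (A *v fst z, snd z)" "\<lambda>u. (B *v u, 0 :: real^'n)"
  "\<lambda>(p :: (real^'n^'k) \<times> (real^'n^'k)) z. fst p *v fst z + snd p *v snd z"
  "\<lambda>z w. (fst z - snd z) \<bullet> (Q *v (fst w - snd w))" "\<lambda>u v. u \<bullet> (R *v v)" \<gamma> r
proof (rule linear_quadratic.intro)
  note mv = matrix_vector_right_distrib matrix_vector_mult_scaleR
      matrix_vector_mult_add_rdistrib scaleR_matrix_vector_assoc[symmetric]
      matrix_vector_mult_diff_distrib
  show "linear (\<lambda>z :: (real^'n) \<times> (real^'n). (A *v fst z, snd z))" "linear (\<lambda>u. (B *v u, 0 :: real^'n))"
    by (simp_all add: linear_iff mv)
  show "bilinear (\<lambda>(p :: (real^'n^'k) \<times> (real^'n^'k)) z. fst p *v fst z + snd p *v snd z)"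
    by (simp add: bilinear_def linear_iff mv algebra_simps)
  show "bilinear (\<lambda>z w :: (real^'n) \<times> (real^'n). (fst z - snd z) \<bullet> (Q *v (fst w - snd w)))"
    by (simp add: bilinear_def linear_iff mv inner_add_left inner_add_right inner_diff_left inner_diff_right algebra_simps)
  show "bilinear (\<lambda>u v. u \<bullet> (R *v v))" by (rule bilinear_matrix_form)
  show "0 \<le> (fst z - snd z) \<bullet> (Q *v (fst z - snd z))" for z :: "(real^'n) \<times> (real^'n)"
    by (rule order_trans[OF _ l(2)]) (use l in simp)
qed (use r \<gamma> Q R sym_form in auto)

abbreviation "traj p x t \<equiv> trajectory A B xs (fst p) (snd p) x t"
abbreviation "J p \<equiv> tracking_cost A B Q R S \<gamma> xs (fst p) (snd p)"
abbreviation "\<nu> \<equiv> normal_vec 0 S"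

lemma loop_funpow: "(loop p ^^ t) (x, xs) = (traj p x t, xs)"
  by (induction t) (simp_all add: loop_def policy_input_def)

lemma stage_cost_eq:
  "stage_cost Q R xs (traj p x t) (policy_input (fst p) (snd p) xs (traj p x t))
    = cost p ((loop p ^^ t) (x, xs)) ((loop p ^^ t) (x, xs))"
  by (simp add: loop_funpow stage_cost_def policy_input_def cost_def)

lemma J_eq: "J p = (\<integral>\<^sup>+x. (\<Sum>t. ennreal (\<gamma> ^ t * cost p ((loop p ^^ t) (x, xs)) ((loop p ^^ t) (x, xs)))) \<partial>\<nu>)"
  by (simp add: tracking_cost_def stage_cost_eq)

text \<open>
  Only \<open>A + B K\<close> has to be controlled: the constant second component and the constant drive that it
  exerts on the first one are damped by the discount. Accordingly the growth rate \<open>c\<close> is taken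
  above 1 and above the spectral radius, with \<open>\<gamma> c\<^sup>2 < 1\<close>.
\<close>
lemma stable_if_spec_radius:
  assumes "sqrt \<gamma> * spec_radius (A + B ** fst p) < 1"
  shows "mean_square_stable \<gamma> (loop p)"
  unfolding mean_square_stable_def
proof (intro conjI linear_loop allI)
  fix z :: "(real^'n) \<times> (real^'n)"
  obtain x y where z: "z = (x, y)" by (cases z)
  let ?M = "A + B ** fst p" and ?w = "B *v (snd p *v y)"
  have "sqrt \<gamma> < 1" "0 < sqrt \<gamma>" using \<gamma> by auto
  then have "max 1 (spec_radius ?M) < 1 / sqrt \<gamma>" using assms by (simp add: field_simps)
  then obtain c where c: "max 1 (spec_radius ?M) < c" "c < 1 / sqrt \<gamma>" using dense by blast
  then have c1: "1 < c" "spec_radius ?M < c" by auto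
  have "sqrt \<gamma> * c < 1" using c(2) \<open>0 < sqrt \<gamma>\<close> by (simp add: field_simps)
  then have "(sqrt \<gamma> * c)\<^sup>2 < 1" using c1 \<gamma> by (simp add: abs_square_less_1)
  then have \<gamma>c: "\<gamma> * c\<^sup>2 < 1" using \<gamma> by (simp add: power_mult_distrib)
  obtain C where C: "0 \<le> C" "\<And>t. norm ((((*v) ?M) ^^ t) x) \<le> C * c ^ t"
    using orbit_bounded_if_spec_radius_less[OF c1(2)] c1(1) by fastforce
  obtain D where D: "0 \<le> D" "\<And>t. norm ((((*v) ?M) ^^ t) ?w) \<le> D * c ^ t"
    using orbit_bounded_if_spec_radius_less[OF c1(2)] c1(1) by fastforce
  have orbit: "(loop p ^^ t) z = ((((*v) ?M) ^^ t) x + (\<Sum>s<t. (((*v) ?M) ^^ s) ?w), y)" for t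
  proof (induction t)
    case (Suc t)
    have "?M *v (\<Sum>s<t. (((*v) ?M) ^^ s) ?w) + ?w = (\<Sum>s<Suc t. (((*v) ?M) ^^ s) ?w)"
      unfolding sum.lessThan_Suc_shift
      by (simp add: linear_sum[OF matrix_vector_mul_linear])
    moreover have "loop p (u, y) = (?M *v u + ?w, y)" for u
      by (simp add: loop_def matrix_vector_mult_add_rdistrib matrix_vector_right_distrib
          matrix_vector_mul_assoc)
    ultimately show ?case
      by (simp add: Suc.IH matrix_vector_right_distrib add.assoc del: sum.lessThan_Suc)
  qed (simp add: z)
  define E where "E = C + D / (c - 1)"
  have "0 \<le> E" using C D c1 by (simp add: E_def)
  have fst_bound: "norm (fst ((loop p ^^ t) z)) \<le> E * c ^ t" for t
  proof -
    have "norm (fst ((loop p ^^ t) z)) \<le> C * c ^ t + (\<Sum>s<t. D * c ^ s)"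
      unfolding orbit fst_conv
      by (intro order_trans[OF norm_triangle_ineq] add_mono C order_trans[OF norm_sum] sum_mono D)
    also have "(\<Sum>s<t. D * c ^ s) = D * ((c ^ t - 1) / (c - 1))"
      using c1 by (simp add: sum_distrib_left[symmetric] geometric_sum)
    also have "C * c ^ t + D * ((c ^ t - 1) / (c - 1)) \<le> C * c ^ t + D * (c ^ t / (c - 1))"
      using c1 C D by (intro add_mono mult_left_mono divide_right_mono) auto
    finally show ?thesis by (simp add: E_def algebra_simps)
  qed
  have bound: "\<gamma> ^ t * (norm ((loop p ^^ t) z))\<^sup>2 \<le> (E\<^sup>2 + (norm y)\<^sup>2) * (\<gamma> * c\<^sup>2) ^ t" for t
  proof -
    have "(norm ((loop p ^^ t) z))\<^sup>2 = (norm (fst ((loop p ^^ t) z)))\<^sup>2 + (norm y)\<^sup>2"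
      by (simp add: orbit norm_Pair)
    also have "\<dots> \<le> (E * c ^ t)\<^sup>2 + (norm y)\<^sup>2 * (c\<^sup>2) ^ t"
      using c1 by (intro add_mono power_mono fst_bound) (auto simp: mult_le_cancel_left1 one_le_power)
    also have "\<dots> = (E\<^sup>2 + (norm y)\<^sup>2) * (c\<^sup>2) ^ t"
      by (simp add: power_mult_distrib algebra_simps power_mult[symmetric] mult.commute)
    finally have "\<gamma> ^ t * (norm ((loop p ^^ t) z))\<^sup>2 \<le> \<gamma> ^ t * ((E\<^sup>2 + (norm y)\<^sup>2) * (c\<^sup>2) ^ t)"
      using \<gamma> by (intro mult_left_mono) auto
    then show ?thesis by (simp add: power_mult_distrib mult_ac)
  qed
  show "summable (\<lambda>t. \<gamma> ^ t * (norm ((loop p ^^ t) z))\<^sup>2)"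
  proof (rule summable_comparison_test'[where N = 0])
    show "summable (\<lambda>t. (E\<^sup>2 + (norm y)\<^sup>2) * (\<gamma> * c\<^sup>2) ^ t)"
      using \<gamma>c \<gamma> by (intro summable_mult summable_geometric) simp
    show "norm (\<gamma> ^ t * (norm ((loop p ^^ t) z))\<^sup>2) \<le> (E\<^sup>2 + (norm y)\<^sup>2) * (\<gamma> * c\<^sup>2) ^ t" for t
      using bound[of t] \<gamma> by simp
  qed
qed

lemma continuous_on_bilinear_initial:
  assumes "bilinear (s :: (real^'n) \<times> (real^'n) \<Rightarrow> (real^'n) \<times> (real^'n) \<Rightarrow> real)"
  shows "continuous_on UNIV (\<lambda>x. s (x, xs) (x, xs))"
proof -
  have "bounded_bilinear s" using assms by (simp add: bilinear_conv_bounded_bilinear)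
  then show ?thesis by (rule bounded_bilinear.continuous_on) (intro continuous_intros)+
qed

lemma integrable_bilinear_initial:
  assumes s: "bilinear (s :: (real^'n) \<times> (real^'n) \<Rightarrow> (real^'n) \<times> (real^'n) \<Rightarrow> real)"
  shows "integrable \<nu> (\<lambda>x. s (x, xs) (x, xs))"
proof -
  obtain K where K: "0 < K" "\<And>z w. norm (s z w) \<le> K * norm z * norm w"
    using bilinear_bounded_pos[OF s] by metis
  have "\<bar>s (x, xs) (x, xs)\<bar> \<le> K * (1 + (norm xs)\<^sup>2) * (1 + (norm x)\<^sup>2)" for x
  proof -
    have "\<bar>s (x, xs) (x, xs)\<bar> \<le> K * ((norm x)\<^sup>2 + (norm xs)\<^sup>2)"
      using K(2)[of "(x, xs)" "(x, xs)"] by (simp add: norm_Pair mult.assoc)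
    also have "\<dots> \<le> K * ((1 + (norm xs)\<^sup>2) * (1 + (norm x)\<^sup>2))"
      using K(1) by (intro mult_left_mono) (auto simp: algebra_simps)
    finally show ?thesis by (simp add: mult.assoc)
  qed
  then show ?thesis
    by (intro integrable_normal_vec_quadratic[OF S] borel_measurable_continuous_onI
        continuous_on_bilinear_initial s)
qed

lemma J_eq_integral:
  assumes "mean_square_stable \<gamma> (loop p)"
  shows "J p = ennreal (\<integral>x. val p (x, xs) (x, xs) \<partial>\<nu>)"
proof -
  have "(\<Sum>t. ennreal (\<gamma> ^ t * cost p ((loop p ^^ t) z) ((loop p ^^ t) z))) = ennreal (val p z z)" for z
    unfolding val_def discounted_form_def using \<gamma>
    by (intro suminf_ennreal2 summable_discounted_form assms bilinear_cost) (auto simp: cost_nonneg)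
  then show ?thesis
    unfolding J_eq
    by (simp add: nn_integral_eq_integral integrable_bilinear_initial[OF bilinear_val[OF assms]] val_nonneg[OF assms])
qed

lemma enn2real_J:
  assumes "mean_square_stable \<gamma> (loop p)"
  shows "enn2real (J p) = (\<integral>x. val p (x, xs) (x, xs) \<partial>\<nu>)"
  unfolding J_eq_integral[OF assms]
  by (intro enn2real_ennreal integral_nonneg_AE) (simp add: val_nonneg[OF assms])

definition J_deriv where
  "J_deriv p h = (\<integral>x. val_deriv p h (x, xs) \<partial>\<nu>)"

lemma integrable_val_deriv:
  assumes "mean_square_stable \<gamma> (loop p)"
  shows "integrable \<nu> (\<lambda>x. val_deriv p h (x, xs))"
  using integrable_bilinear_initial[OF bilinear_discounted_form[OF assms bilinear_dir_form[OF assms] \<gamma>(1)]]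
  by (simp add: val_deriv_def)

lemma linear_J_deriv:
  assumes st: "mean_square_stable \<gamma> (loop p)"
  shows "linear (J_deriv p)"
  by (rule linearI)
    (simp_all add: J_deriv_def linear_add[OF linear_val_deriv[OF st]] linear_scale[OF linear_val_deriv[OF st]]
      Bochner_Integration.integral_add[OF integrable_val_deriv[OF st] integrable_val_deriv[OF st]])

lemma J_has_derivative:
  assumes st: "mean_square_stable \<gamma> (loop p)"
  shows "((\<lambda>p. enn2real (J p)) has_derivative J_deriv p) (at p)"
proof -
  obtain \<eta> C where \<eta>: "0 < \<eta>" "0 < C" and
    st': "\<And>h. norm h < \<eta> \<Longrightarrow> mean_square_stable \<gamma> (loop (p + h))" and
    rem: "\<And>h z. norm h < \<eta> \<Longrightarrow>
       \<bar>val (p + h) z z - val p z z - val_deriv p h z\<bar> \<le> C * (norm h)\<^sup>2 * (norm z)\<^sup>2"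
    by (rule val_has_derivative_bound[OF st]) (rule that)
  define m where "m = (\<integral>x. (norm (x, xs))\<^sup>2 \<partial>\<nu>)"
  have int_sq: "integrable \<nu> (\<lambda>x. (norm (x, xs))\<^sup>2)"
    unfolding power2_norm_eq_inner by (rule integrable_bilinear_initial[OF bilinear_inner])
  have "\<bar>enn2real (J (p + h)) - enn2real (J p) - J_deriv p h\<bar> \<le> (C * m) * (norm h)\<^sup>2"
    if h: "norm h < \<eta>" for h
  proof -
    note int = integrable_bilinear_initial[OF bilinear_val[OF st'[OF h]]]
      integrable_bilinear_initial[OF bilinear_val[OF st]] integrable_val_deriv[OF st, of h]
    have diff: "enn2real (J (p + h)) - enn2real (J p) - J_deriv p h
        = (\<integral>x. val (p + h) (x, xs) (x, xs) - val p (x, xs) (x, xs) - val_deriv p h (x, xs) \<partial>\<nu>)"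
      unfolding enn2real_J[OF st] enn2real_J[OF st'[OF h]] J_deriv_def using int by simp
    have "\<bar>enn2real (J (p + h)) - enn2real (J p) - J_deriv p h\<bar>
        \<le> (\<integral>x. \<bar>val (p + h) (x, xs) (x, xs) - val p (x, xs) (x, xs) - val_deriv p h (x, xs)\<bar> \<partial>\<nu>)"
      unfolding diff by (rule integral_abs_bound)
    also have "\<dots> \<le> (\<integral>x. C * (norm h)\<^sup>2 * (norm (x, xs))\<^sup>2 \<partial>\<nu>)"
    proof (rule integral_mono)
      show "integrable \<nu> (\<lambda>x. \<bar>val (p + h) (x, xs) (x, xs) - val p (x, xs) (x, xs) - val_deriv p h (x, xs)\<bar>)"
        using int by simp
      show "integrable \<nu> (\<lambda>x. C * (norm h)\<^sup>2 * (norm (x, xs))\<^sup>2)"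
        by (rule integrable_mult_right) (rule int_sq)
    qed (rule rem[OF h])
    also have "\<dots> = C * m * (norm h)\<^sup>2" by (simp add: m_def mult_ac)
    finally show ?thesis .
  qed
  then show ?thesis
    by (intro has_derivative_if_quadratic_remainder[OF linear_J_deriv[OF st] \<eta>(1)])
qed

text \<open>
  On the states \<open>(x, xs)\<close> that occur, the input gradient is the affine function
  \<open>gain_grad p x + offset_grad p\<close> of \<open>x\<close>.
\<close>
definition gain_grad :: "(real^'n^'k) \<times> (real^'n^'k) \<Rightarrow> real^'n^'k" where
  "gain_grad p = matrix (\<lambda>x. input_grad p (x, 0))"

definition offset_grad :: "(real^'n^'k) \<times> (real^'n^'k) \<Rightarrow> real^'k" where
  "offset_grad p = input_grad p (0, xs)"

definition grad_size :: "(real^'n^'k) \<times> (real^'n^'k) \<Rightarrow> real" where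
  "grad_size p = (norm (gain_grad p))\<^sup>2 + (norm (offset_grad p))\<^sup>2"

lemma input_grad_affine:
  assumes st: "mean_square_stable \<gamma> (loop p)"
  shows "input_grad p (x, xs) = gain_grad p *v x + offset_grad p"
proof -
  have "linear (\<lambda>x. input_grad p (x, 0))"
    using linear_compose[OF _ linear_input_grad[OF st], of "\<lambda>x. (x, 0)"]
    by (simp add: o_def linear_iff)
  then have "gain_grad p *v x = input_grad p (x, 0)"
    by (simp add: gain_grad_def matrix_works)
  then show ?thesis
    using linear_add[OF linear_input_grad[OF st], of "(x, 0)" "(0, xs)"]
    by (simp add: offset_grad_def)
qed

text \<open>
  The direction in policy space that changes the input at \<open>(x, xs)\<close> by exactly the input gradient. The
  second gain acts on \<open>xs\<close> only, so the offset is produced by the matrix of rank one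
  \<open>offset xs\<^sup>T / |xs|\<^sup>2\<close>. If \<open>xs = 0\<close>, this matrix is zero, and so is the offset of a stable policy, by
  linearity.
\<close>
definition ascent :: "(real^'n^'k) \<times> (real^'n^'k) \<Rightarrow> (real^'n^'k) \<times> (real^'n^'k)" where
  "ascent p = (gain_grad p, \<chi> i. (offset_grad p $ i / (xs \<bullet> xs)) *\<^sub>R xs)"

lemma ascent_input:
  assumes st: "mean_square_stable \<gamma> (loop p)"
  shows "fst (ascent p) *v x + snd (ascent p) *v xs = input_grad p (x, xs)"
proof -
  have "snd (ascent p) *v xs = offset_grad p"
  proof (cases "xs = 0")
    case True
    then have "offset_grad p = 0"
      unfolding offset_grad_def using linear_0[OF linear_input_grad[OF st]] by (simp add: zero_prod_def)
    moreover have "snd (ascent p) *v xs = 0" using True by simp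
    ultimately show ?thesis by metis
  qed (auto simp: vec_eq_iff ascent_def matrix_vector_mul_component)
  then show ?thesis by (simp add: input_grad_affine[OF st] ascent_def)
qed

lemma norm_ascent:
  "(norm (ascent p))\<^sup>2 \<le> max 1 (1 / (norm xs)\<^sup>2) * grad_size p"
proof -
  let ?e = "offset_grad p"
  have e: "(\<Sum>i\<in>UNIV. (?e $ i)\<^sup>2) = (norm ?e)\<^sup>2"
    by (simp add: norm_vec_def L2_set_def sum_nonneg)
  have "(norm (snd (ascent p)))\<^sup>2 = (\<Sum>i\<in>UNIV. (?e $ i)\<^sup>2 * (1 / (norm xs)\<^sup>2))"
    unfolding norm_matrix_power2
    by (intro sum.cong refl) (simp add: ascent_def power_mult_distrib power_divide dot_square_norm power2_eq_square)
  also have "\<dots> = (1 / (norm xs)\<^sup>2) * (norm ?e)\<^sup>2"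
    unfolding sum_distrib_right[symmetric] e by simp
  finally have "(norm (ascent p))\<^sup>2 = 1 * (norm (gain_grad p))\<^sup>2 + (1 / (norm xs)\<^sup>2) * (norm ?e)\<^sup>2"
    by (simp add: norm_prod_def ascent_def)
  also have "\<dots> \<le> max 1 (1 / (norm xs)\<^sup>2) * (norm (gain_grad p))\<^sup>2 + max 1 (1 / (norm xs)\<^sup>2) * (norm ?e)\<^sup>2"
    by (intro add_mono mult_right_mono) auto
  finally show ?thesis by (simp add: grad_size_def distrib_left)
qed

text \<open>
  Along the direction \<open>ascent p\<close> every stage contributes the nonnegative term
  \<open>2 \<gamma>\<^sup>t |input_grad|\<^sup>2\<close>. The first stage alone suffices, because the initial distribution is not
  degenerate.
\<close>
lemma J_deriv_ascent_ge:
  assumes st: "mean_square_stable \<gamma> (loop p)"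
    and c: "\<And>a b. c * ((norm a)\<^sup>2 + b\<^sup>2) \<le> (\<integral>x. (a \<bullet> x + b)\<^sup>2 \<partial>\<nu>)"
  shows "2 * (c * grad_size p) \<le> J_deriv p (ascent p)"
proof -
  let ?E = "gain_grad p" and ?e = "offset_grad p"
  have int: "integrable \<nu> (\<lambda>x. (a \<bullet> x + b)\<^sup>2)" for a b
  proof (rule integrable_normal_vec_quadratic[OF S])
    show "(\<lambda>x. (a \<bullet> x + b)\<^sup>2) \<in> borel_measurable borel" by measurable
    fix x
    have "(a \<bullet> x + b)\<^sup>2 \<le> 2 * (a \<bullet> x)\<^sup>2 + 2 * b\<^sup>2"
      using sum_squares_bound[of "a \<bullet> x" b] by (simp add: power2_sum)
    also have "(a \<bullet> x)\<^sup>2 \<le> (norm a)\<^sup>2 * (norm x)\<^sup>2"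
      using Cauchy_Schwarz_ineq[of a x] by (simp add: power2_norm_eq_inner)
    finally have "(a \<bullet> x + b)\<^sup>2 \<le> 2 * ((norm a)\<^sup>2 * (norm x)\<^sup>2) + 2 * b\<^sup>2" by simp
    also have "\<dots> \<le> 2 * ((norm a)\<^sup>2 + b\<^sup>2) * (1 + (norm x)\<^sup>2)"
      by (simp add: algebra_simps)
    finally show "\<bar>(a \<bullet> x + b)\<^sup>2\<bar> \<le> 2 * ((norm a)\<^sup>2 + b\<^sup>2) * (1 + (norm x)\<^sup>2)" by simp
  qed
  have "c * grad_size p = (\<Sum>i\<in>UNIV. c * ((norm (?E $ i))\<^sup>2 + (?e $ i)\<^sup>2))"
    by (simp add: grad_size_def norm_matrix_power2 sum_distrib_left[symmetric] sum.distrib norm_vec_def[of ?e]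
        L2_set_def sum_nonneg)
  also have "\<dots> \<le> (\<Sum>i\<in>UNIV. \<integral>x. (?E $ i \<bullet> x + ?e $ i)\<^sup>2 \<partial>\<nu>)"
    by (intro sum_mono c)
  also have "\<dots> = (\<integral>x. (norm (input_grad p (x, xs)))\<^sup>2 \<partial>\<nu>)"
    by (simp add: input_grad_affine[OF st] norm_matrix_vector_affine Bochner_Integration.integral_sum int)
  also have "\<dots> \<le> (\<integral>x. val_deriv p (ascent p) (x, xs) / 2 \<partial>\<nu>)"
  proof (intro integral_mono)
    show "integrable \<nu> (\<lambda>x. (norm (input_grad p (x, xs)))\<^sup>2)"
      by (simp add: input_grad_affine[OF st] norm_matrix_vector_affine int)
    show "integrable \<nu> (\<lambda>x. val_deriv p (ascent p) (x, xs) / 2)"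
      by (intro integrable_divide integrable_val_deriv[OF st])
    fix x
    have term_eq: "dir_form p (ascent p) ((loop p ^^ t) (x, xs)) ((loop p ^^ t) (x, xs))
        = (norm (input_grad p ((loop p ^^ t) (x, xs))))\<^sup>2" for t
      by (simp add: dir_form_def loop_funpow ascent_input[OF st] power2_norm_eq_inner)
    have "(\<Sum>t<1. \<gamma> ^ t * dir_form p (ascent p) ((loop p ^^ t) (x, xs)) ((loop p ^^ t) (x, xs)))
        \<le> discounted_form \<gamma> (loop p) (dir_form p (ascent p)) (x, xs) (x, xs)"
      unfolding discounted_form_def using \<gamma>
      by (intro sum_le_suminf summable_discounted_form st bilinear_dir_form) (auto simp: term_eq)
    then show "(norm (input_grad p (x, xs)))\<^sup>2 \<le> val_deriv p (ascent p) (x, xs) / 2"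
      using term_eq[of 0] by (simp add: val_deriv_def)
  qed
  also have "\<dots> = J_deriv p (ascent p) / 2" by (simp add: J_deriv_def)
  finally show ?thesis by simp
qed

text \<open>
  The excess of \<open>p\<close> over a competitor \<open>p'\<close> is bounded by the input gradient summed along the trajectory
  of \<open>p'\<close>, and the size of that trajectory is bounded by its own cost \<open>v\<close>, as \<open>Q\<close> is positive definite.
  So finite cost of \<open>p'\<close> at this initial state suffices.
\<close>
lemma val_le_competitor:
  assumes st: "mean_square_stable \<gamma> (loop p)"
    and sm: "summable (\<lambda>t. \<gamma> ^ t * cost p' ((loop p' ^^ t) (x, xs)) ((loop p' ^^ t) (x, xs)))"
  defines "v \<equiv> (\<Sum>t. \<gamma> ^ t * cost p' ((loop p' ^^ t) (x, xs)) ((loop p' ^^ t) (x, xs)))"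
  shows "val p (x, xs) (x, xs)
    \<le> v + grad_size p * (4 / (r * l) * v + 2 * (2 * (norm xs)\<^sup>2 + 1) / (r * (1 - \<gamma>)))"
proof -
  let ?x = "\<lambda>t. traj p' x t"
  let ?k = "\<lambda>t. cost p' ((loop p' ^^ t) (x, xs)) ((loop p' ^^ t) (x, xs))"
  have geo: "summable (\<lambda>t. \<gamma> ^ t)" "(\<Sum>t. \<gamma> ^ t) = 1 / (1 - \<gamma>)"
    using \<gamma> by (auto simp: suminf_geometric intro: summable_geometric)
  have state: "(norm (?x t))\<^sup>2 \<le> 2 / l * ?k t + 2 * (norm xs)\<^sup>2" for t
  proof -
    have "(norm (?x t))\<^sup>2 \<le> (norm (?x t - xs) + norm xs)\<^sup>2"
      by (intro power_mono norm_triangle_sub[THEN order_trans]) (auto simp: add.commute)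
    also have "\<dots> \<le> 2 * (norm (?x t - xs))\<^sup>2 + 2 * (norm xs)\<^sup>2"
      using sum_squares_bound[of "norm (?x t - xs)" "norm xs"] by (simp add: power2_sum)
    also have "l * (norm (?x t - xs))\<^sup>2 \<le> ?k t"
      using l(2)[of "?x t - xs"] R_nonneg by (simp add: loop_funpow cost_def add_increasing2)
    then have "(norm (?x t - xs))\<^sup>2 \<le> ?k t / l" using l(1) by (simp add: field_simps)
    finally show ?thesis by simp
  qed
  define y where "y t = 2 / l * (\<gamma> ^ t * ?k t) + (2 * (norm xs)\<^sup>2 + 1) * \<gamma> ^ t" for t
  have y: "y sums (2 / l * v + (2 * (norm xs)\<^sup>2 + 1) * (1 / (1 - \<gamma>)))"
    unfolding y_def v_def geo(2)[symmetric]
    by (intro sums_add sums_mult summable_sums sm geo(1))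
  have state_y: "\<gamma> ^ t * ((norm (?x t))\<^sup>2 + 1) \<le> y t" for t
    using mult_left_mono[OF state[of t], of "\<gamma> ^ t"] \<gamma> by (simp add: y_def algebra_simps)
  have sm_z: "summable (\<lambda>t. \<gamma> ^ t * (norm ((loop p' ^^ t) (x, xs)))\<^sup>2)"
  proof (rule summable_comparison_test'[where N = 0])
    show "summable (\<lambda>t. y t + (norm xs)\<^sup>2 * \<gamma> ^ t)"
      by (intro summable_add summable_mult geo(1) sums_summable[OF y])
    show "norm (\<gamma> ^ t * (norm ((loop p' ^^ t) (x, xs)))\<^sup>2) \<le> y t + (norm xs)\<^sup>2 * \<gamma> ^ t" for t
      using state_y[of t] \<gamma> by (simp add: loop_funpow norm_Pair algebra_simps)
        (smt (verit) zero_le_power)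
  qed
  have grad: "\<gamma> ^ t * (norm (input_grad p ((loop p' ^^ t) (x, xs))))\<^sup>2 \<le> 2 * grad_size p * y t" for t
  proof -
    have "norm (input_grad p (?x t, xs)) \<le> norm (gain_grad p) * norm (?x t) + norm (offset_grad p)"
      unfolding input_grad_affine[OF st]
      by (intro order_trans[OF norm_triangle_ineq] add_mono norm_matrix_vector_le order_refl)
    then have "(norm (input_grad p (?x t, xs)))\<^sup>2 \<le> (norm (gain_grad p) * norm (?x t) + norm (offset_grad p))\<^sup>2"
      by (intro power_mono) auto
    also have "\<dots> \<le> 2 * ((norm (gain_grad p))\<^sup>2 * (norm (?x t))\<^sup>2) + 2 * (norm (offset_grad p))\<^sup>2"
      using sum_squares_bound[of "norm (gain_grad p) * norm (?x t)" "norm (offset_grad p)"]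
      by (simp add: power2_sum power_mult_distrib)
    also have "\<dots> \<le> 2 * grad_size p * ((norm (?x t))\<^sup>2 + 1)"
      by (simp add: grad_size_def algebra_simps)
    finally have "\<gamma> ^ t * (norm (input_grad p (?x t, xs)))\<^sup>2 \<le> \<gamma> ^ t * (2 * grad_size p * ((norm (?x t))\<^sup>2 + 1))"
      using \<gamma> by (intro mult_left_mono) auto
    also have "\<dots> = 2 * grad_size p * (\<gamma> ^ t * ((norm (?x t))\<^sup>2 + 1))" by simp
    also have "\<dots> \<le> 2 * grad_size p * y t"
      by (intro mult_left_mono state_y) (simp add: grad_size_def)
    finally show ?thesis by (simp add: loop_funpow)
  qed
  have sm_y: "summable (\<lambda>t. 2 * grad_size p * y t)" by (intro summable_mult sums_summable[OF y])
  have "summable (\<lambda>t. \<gamma> ^ t * (norm (input_grad p ((loop p' ^^ t) (x, xs))))\<^sup>2)"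
    by (rule summable_comparison_test'[OF sm_y, where N = 0]) (use grad \<gamma> in simp)
  then have "(\<Sum>t. \<gamma> ^ t * (norm (input_grad p ((loop p' ^^ t) (x, xs))))\<^sup>2) \<le> (\<Sum>t. 2 * grad_size p * y t)"
    by (rule suminf_le[OF grad _ sm_y])
  also have "\<dots> = 2 * grad_size p * (2 / l * v + (2 * (norm xs)\<^sup>2 + 1) * (1 / (1 - \<gamma>)))"
    using sums_unique[OF y] by (simp add: suminf_mult[OF sums_summable[OF y]])
  finally have "(\<Sum>t. \<gamma> ^ t * (norm (input_grad p ((loop p' ^^ t) (x, xs))))\<^sup>2) / r
      \<le> 2 * grad_size p * (2 / l * v + (2 * (norm xs)\<^sup>2 + 1) * (1 / (1 - \<gamma>))) / r"
    using r by (intro divide_right_mono) auto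
  also have "\<dots> = grad_size p * (4 / (r * l) * v + 2 * (2 * (norm xs)\<^sup>2 + 1) / (r * (1 - \<gamma>)))"
    using r(1) l(1) \<gamma> by (simp add: field_simps)
  finally show ?thesis
    using val_le_cost_plus_gradient[OF st, of "p' - p" "(x, xs)"] sm_z
    by (simp add: v_def)
qed

text \<open>
  The coefficients of \<open>grad_size p * v\<close> and of \<open>grad_size p\<close> in the preceding bound, the latter
  integrated over the initial state. They do not depend on the policy.
\<close>
definition defect_slope :: real where
  "defect_slope = 4 / (r * l)"

definition defect_const :: real where
  "defect_const = 2 * (2 * (norm xs)\<^sup>2 + 1) / (r * (1 - \<gamma>)) * (\<integral>x. 1 \<partial>\<nu>)"

lemma defect_nonneg: "0 \<le> defect_slope" "0 \<le> defect_const"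
  using r l \<gamma> by (auto simp: defect_slope_def defect_const_def)

text \<open>
  At initial states where the competitor has infinite cost the pointwise bound is trivial, so it
  holds for every \<open>x\<close> and can be integrated.
\<close>
lemma J_le_competitor:
  assumes st: "mean_square_stable \<gamma> (loop p)"
  shows "J p \<le> ennreal (1 + grad_size p * defect_slope) * J p' + ennreal (grad_size p * defect_const)"
proof -
  let ?v = "\<lambda>x. \<Sum>t. ennreal (\<gamma> ^ t * cost p' ((loop p' ^^ t) (x, xs)) ((loop p' ^^ t) (x, xs)))"
  define b where "b = 2 * (2 * (norm xs)\<^sup>2 + 1) / (r * (1 - \<gamma>))"
  have b: "0 \<le> b" using r \<gamma> by (simp add: b_def)
  have g: "0 \<le> grad_size p" by (simp add: grad_size_def)
  have int1: "integrable \<nu> (\<lambda>x. 1 :: real)"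
    by (rule integrable_normal_vec_quadratic[OF S, where C = 1]) auto
  have nn: "0 \<le> \<gamma> ^ t * cost p' ((loop p' ^^ t) (x, xs)) ((loop p' ^^ t) (x, xs))" for t x
    using \<gamma> cost_nonneg by simp
  have pointwise: "ennreal (val p (x, xs) (x, xs))
      \<le> ennreal (1 + grad_size p * defect_slope) * ?v x + ennreal (grad_size p * b)" for x
  proof (cases "?v x = top")
    case True
    have "0 < 1 + grad_size p * defect_slope"
      using g defect_nonneg by (simp add: add_pos_nonneg)
    then show ?thesis using True by (simp add: ennreal_mult_top)
  next
    case False
    define v where "v = (\<Sum>t. \<gamma> ^ t * cost p' ((loop p' ^^ t) (x, xs)) ((loop p' ^^ t) (x, xs)))"
    have sm: "summable (\<lambda>t. \<gamma> ^ t * cost p' ((loop p' ^^ t) (x, xs)) ((loop p' ^^ t) (x, xs)))"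
      by (rule summable_suminf_not_top[OF nn False])
    have v: "?v x = ennreal v" "0 \<le> v"
      unfolding v_def using suminf_ennreal2[OF nn sm] suminf_nonneg[OF sm nn] by auto
    have "val p (x, xs) (x, xs) \<le> v + grad_size p * (defect_slope * v + b)"
      using val_le_competitor[OF st sm] by (simp add: v_def defect_slope_def b_def)
    also have "\<dots> = (1 + grad_size p * defect_slope) * v + grad_size p * b"
      by (simp add: algebra_simps)
    finally have "ennreal (val p (x, xs) (x, xs)) \<le> ennreal ((1 + grad_size p * defect_slope) * v + grad_size p * b)"
      by (rule ennreal_leI)
    also have "\<dots> = ennreal (1 + grad_size p * defect_slope) * ?v x + ennreal (grad_size p * b)"
      using v g b defect_nonneg by (simp add: ennreal_plus ennreal_mult)
    finally show ?thesis .
  qed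
  have meas: "?v \<in> borel_measurable \<nu>"
  proof -
    have "(\<lambda>x. cost p' ((loop p' ^^ t) (x, xs)) ((loop p' ^^ t) (x, xs))) \<in> borel_measurable borel" for t
    proof -
      have "bilinear (\<lambda>z w. cost p' ((loop p' ^^ t) z) ((loop p' ^^ t) w))"
        using linear_funpow[OF linear_loop, of t p']
        by (simp add: bilinear_def linear_iff bilinear_ladd[OF bilinear_cost] bilinear_radd[OF bilinear_cost]
            bilinear_lmul[OF bilinear_cost] bilinear_rmul[OF bilinear_cost] del: split_paired_All)
      from continuous_on_bilinear_initial[OF this] show ?thesis
        by (rule borel_measurable_continuous_onI)
    qed
    then show ?thesis by measurable
  qed
  have "J p = (\<integral>\<^sup>+x. ennreal (val p (x, xs) (x, xs)) \<partial>\<nu>)"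
    unfolding J_eq_integral[OF st]
    by (simp add: nn_integral_eq_integral integrable_bilinear_initial[OF bilinear_val[OF st]] val_nonneg[OF st])
  also have "\<dots> \<le> (\<integral>\<^sup>+x. ennreal (1 + grad_size p * defect_slope) * ?v x + ennreal (grad_size p * b) \<partial>\<nu>)"
    by (intro nn_integral_mono pointwise)
  also have "\<dots> = ennreal (1 + grad_size p * defect_slope) * J p' + (\<integral>\<^sup>+x. ennreal (grad_size p * b * 1) \<partial>\<nu>)"
    unfolding J_eq using meas by (simp add: nn_integral_add nn_integral_cmult)
  also have "(\<integral>\<^sup>+x. ennreal (grad_size p * b * 1) \<partial>\<nu>) = ennreal (\<integral>x. grad_size p * b * 1 \<partial>\<nu>)"
    using g b by (intro nn_integral_eq_integral integrable_mult_right int1) auto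
  also have "(\<integral>x. grad_size p * b * 1 \<partial>\<nu>) = grad_size p * defect_const"
    by (simp add: defect_const_def b_def)
  finally show ?thesis .
qed

abbreviation "J_opt \<equiv> optimal_cost A B Q R S \<gamma> xs"

text \<open>
  The preceding bound is affine and increasing in the cost of the competitor, so it passes to the
  infimum.
\<close>
lemma J_le_optimal:
  assumes st: "mean_square_stable \<gamma> (loop p)"
  shows "enn2real (J p) - enn2real J_opt
    \<le> grad_size p * (defect_slope * enn2real J_opt + defect_const)"
proof -
  define a where "a = 1 + grad_size p * defect_slope"
  define d where "d = grad_size p * defect_const"
  have g: "0 \<le> grad_size p" by (simp add: grad_size_def)
  have a: "0 < a" using g defect_nonneg by (simp add: a_def add_pos_nonneg)
  have d: "0 \<le> d" using g defect_nonneg by (simp add: d_def)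
  have Jp: "J p = ennreal (enn2real (J p))" using J_eq_integral[OF st] by simp
  have "J_opt \<le> J p" unfolding optimal_cost_def by (rule INF_lower) simp
  then have fin: "J_opt < top" using Jp by (metis ennreal_less_top le_less_trans)
  have "ennreal ((enn2real (J p) - d) / a) \<le> J_opt"
    unfolding optimal_cost_def
  proof (rule INF_greatest)
    fix p'
    show "ennreal ((enn2real (J p) - d) / a) \<le> J p'"
    proof (cases "J p' = top")
      case False
      then obtain j where j: "0 \<le> j" "J p' = ennreal j" by (cases "J p'") auto
      have "ennreal (enn2real (J p)) \<le> ennreal (a * j + d)"
        using J_le_competitor[OF st, of p', folded a_def d_def] a d j Jp by (simp add: ennreal_plus ennreal_mult)
      then have "enn2real (J p) \<le> a * j + d" using a d j(1) by (subst (asm) ennreal_le_iff) auto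
      then have "(enn2real (J p) - d) / a \<le> j" using a by (simp add: pos_divide_le_eq mult.commute)
      then show ?thesis unfolding j(2) by (rule ennreal_leI)
    qed simp
  qed
  then have "enn2real (ennreal ((enn2real (J p) - d) / a)) \<le> enn2real J_opt"
    using fin by (intro enn2real_mono) auto
  moreover have "w \<le> enn2real (ennreal w)" for w
    by (cases "0 \<le> w") (auto intro: order_trans[OF _ enn2real_nonneg])
  ultimately have "(enn2real (J p) - d) / a \<le> enn2real J_opt"
    using order_trans by blast
  then have "enn2real (J p) - d \<le> enn2real J_opt * a" using a by (simp add: pos_divide_le_eq)
  then show ?thesis by (simp add: a_def d_def algebra_simps)
qed

text \<open>
  Testing the gradient \<open>G\<close> against \<open>ascent p\<close> gives \<open>2 c grad_size p \<le> |ascent p| |G|\<close>, and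
  \<open>|ascent p|\<^sup>2\<close> is at most a constant times \<open>grad_size p\<close>; hence \<open>grad_size p\<close> is at most a constant
  times \<open>|G|\<^sup>2\<close>.
\<close>
lemma gradient_dominance:
  "\<exists>\<mu>>0. \<forall>p. mean_square_stable \<gamma> (loop p) \<longrightarrow>
     J p < \<infinity> \<and> (\<exists>G. GDERIV (\<lambda>p. enn2real (J p)) p :> G \<and>
       enn2real (J p) - enn2real J_opt \<le> 1 / \<mu> * (norm G)\<^sup>2)"
proof -
  obtain c where c: "0 < c" "\<And>a b. c * ((norm a)\<^sup>2 + b\<^sup>2) \<le> (\<integral>x. (a \<bullet> x + b)\<^sup>2 \<partial>\<nu>)"
    using normal_vec_affine_coercive[OF S] by metis
  define k where "k = max 1 (1 / (norm xs)\<^sup>2)"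
  \<comment> \<open>The summand 1 only ensures that \<open>w\<close> is positive.\<close>
  define w where "w = defect_slope * enn2real J_opt + defect_const + 1"
  have k: "0 < k" by (simp add: k_def)
  have w: "0 < w" using defect_nonneg by (simp add: w_def add_nonneg_pos)
  have "J p < \<infinity> \<and> (\<exists>G. GDERIV (\<lambda>p. enn2real (J p)) p :> G \<and>
       enn2real (J p) - enn2real J_opt \<le> 1 / (4 * c\<^sup>2 / (k * w)) * (norm G)\<^sup>2)"
    if st: "mean_square_stable \<gamma> (loop p)" for p
  proof (intro conjI exI)
    show "J p < \<infinity>" by (simp add: J_eq_integral[OF st])
    define G where "G = adjoint (J_deriv p) 1"
    have G: "J_deriv p = (\<lambda>h. h \<bullet> G)"
      using adjoint_works[OF linear_J_deriv[OF st], of _ 1] by (simp add: G_def)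
    show "GDERIV (\<lambda>p. enn2real (J p)) p :> G"
      unfolding gderiv_def using J_has_derivative[OF st] by (simp add: G)
    let ?s = "grad_size p"
    have s: "0 \<le> ?s" by (simp add: grad_size_def)
    have "2 * (c * ?s) \<le> norm (ascent p) * norm G"
      using J_deriv_ascent_ge[OF st c(2)] Cauchy_Schwarz_ineq2[of "ascent p" G] by (simp add: G)
    then have "(2 * (c * ?s))\<^sup>2 \<le> (norm (ascent p) * norm G)\<^sup>2"
      using c(1) s by (intro power_mono) auto
    also have "\<dots> \<le> (k * ?s) * (norm G)\<^sup>2"
      unfolding power_mult_distrib k_def by (intro mult_right_mono norm_ascent) auto
    finally have "?s * (4 * c\<^sup>2 * ?s) \<le> ?s * (k * (norm G)\<^sup>2)"
      by (simp add: power2_eq_square mult_ac)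
    then have "4 * c\<^sup>2 * ?s \<le> k * (norm G)\<^sup>2"
      using s k by (cases "?s = 0") auto
    then have sG: "?s \<le> k * (norm G)\<^sup>2 / (4 * c\<^sup>2)" using c(1) by (simp add: field_simps)
    have "enn2real (J p) - enn2real J_opt \<le> ?s * w"
      using J_le_optimal[OF st] s by (simp add: w_def algebra_simps)
    also have "\<dots> \<le> k * (norm G)\<^sup>2 / (4 * c\<^sup>2) * w"
      using sG w by (intro mult_right_mono) auto
    finally show "enn2real (J p) - enn2real J_opt \<le> 1 / (4 * c\<^sup>2 / (k * w)) * (norm G)\<^sup>2"
      by (simp add: mult_ac)
  qed
  moreover have "0 < 4 * c\<^sup>2 / (k * w)" using c k w by simp
  ultimately show ?thesis by blast
qed

end

theorem proposition1:
  fixes A Q \<Sigma> :: "real^'n^'n"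
    and B :: "real^'k^'n"
    and R :: "real^'k^'k"
    and \<gamma> :: real
    and xs :: "real^'n"
  assumes "controllable A B"
    and "sym_pos_def Q" and "sym_pos_def R" and "sym_pos_def \<Sigma>"
    and "0 < \<gamma>" and "\<gamma> < 1"
  shows "\<exists>\<mu>>0. \<forall>K Kt :: real^'n^'k.
     sqrt \<gamma> * spec_radius (A + B ** K) < 1 \<longrightarrow>
       tracking_cost A B Q R \<Sigma> \<gamma> xs K Kt < \<infinity> \<and>
       (\<exists>G. GDERIV (\<lambda>p. enn2real (tracking_cost A B Q R \<Sigma> \<gamma> xs (fst p) (snd p))) (K, Kt) :> G \<and>
          enn2real (tracking_cost A B Q R \<Sigma> \<gamma> xs K Kt) - enn2real (optimal_cost A B Q R \<Sigma> \<gamma> xs)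
            \<le> 1 / \<mu> * (norm G)\<^sup>2)"
proof -
  obtain r where r: "0 < r" "\<And>u. r * (norm u)\<^sup>2 \<le> u \<bullet> (R *v u)"
    using sym_pos_def_coercive[OF assms(3)] by metis
  obtain l where l: "0 < l" "\<And>x. l * (norm x)\<^sup>2 \<le> x \<bullet> (Q *v x)"
    using sym_pos_def_coercive[OF assms(2)] by metis
  interpret lqr_tracking A Q \<Sigma> B R \<gamma> r l xs
    using assms r l by unfold_locales auto
  obtain \<mu> where "0 < \<mu>" and \<mu>: "\<And>p. mean_square_stable \<gamma> (loop p) \<Longrightarrow>
     J p < \<infinity> \<and> (\<exists>G. GDERIV (\<lambda>p. enn2real (J p)) p :> G \<and>
       enn2real (J p) - enn2real J_opt \<le> 1 / \<mu> * (norm G)\<^sup>2)"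
    using gradient_dominance by blast
  show ?thesis
  proof (intro exI[of _ \<mu>] conjI[OF \<open>0 < \<mu>\<close>] allI impI)
    fix K Kt :: "real^'n^'k"
    assume "sqrt \<gamma> * spec_radius (A + B ** K) < 1"
    then have "mean_square_stable \<gamma> (loop (K, Kt))" by (intro stable_if_spec_radius) simp
    from \<mu>[OF this] show "tracking_cost A B Q R \<Sigma> \<gamma> xs K Kt < \<infinity> \<and>
       (\<exists>G. GDERIV (\<lambda>p. enn2real (tracking_cost A B Q R \<Sigma> \<gamma> xs (fst p) (snd p))) (K, Kt) :> G \<and>
          enn2real (tracking_cost A B Q R \<Sigma> \<gamma> xs K Kt) - enn2real (optimal_cost A B Q R \<Sigma> \<gamma> xs)
            \<le> 1 / \<mu> * (norm G)\<^sup>2)"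
      by simp
  qed
qed

end
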